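(* Let $C>1$, $Q=(0,1)$ and $x\in\Omega_C$. With the candidates $b_{p,C},B_{2,C},A_{\delta,C},D_{\lambda,C}$, the functions $\varphi_x^\pm,\psi_x,\eta_x$ on $Q$, and the notion of optimizer as defined in the context: (1) The function $\varphi_x^+$ is an optimizer for $b_{p,C}(x)$, $1<p\le2$, and for $A_{\delta,C}(x)$, $1\le\delta<1/\xi^+$. (2) The function $\varphi_x^-$ is an optimizer for $B_{2,C}(x)$. (3) The function $\psi_x$ is an optimizer for $b_{1,C}(x)$. (4) For any $\lambda\in\mathbb R$, the function $\eta_x$ is an optimizer for $D_{\lambda,C}(x)$.
   Context: **Basic notation.** $Q=(0,1)$. For an interval $J$, $\langle\varphi\rangle_J=\frac1{|J|}\int_J\varphi$. For an a.e. positive $w$ on $Q$ with $w,\log w$ locally integrable, $[w]_{A_\infty(Q)}=\sup_{J\subset Q}\langle w\rangle_Je^{-\langle\log w\rangle_J}$ (supremum over all subintervals $J$ of $Q$). For $C>1$, $\Omega_C=\{x\in\mathbb R^2:\ e^{x_1}\le x_2\le Ce^{x_1}\}$, and for $x\in\Omega_C$ $$E_{x,C,Q}=\{\varphi\in L^1(Q):\ \langle\varphi\rangle_Q=x_1,\ \langle e^\varphi\rangle_Q=x_2,\ [e^\varphi]_{A_\infty(Q)}\le C\}.$$ **Optimizers.** If $G$ is one of the candidates below and $x\in\Omega_C$, a function $\varphi$ on $Q$ is an optimizer for $G(x)$ if $\varphi\in E_{x,C,Q}$ and $\langle f(\varphi)\rangle_Q=G(x)$, where $f(t)=|t|^p$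 for $G=b_{p,C}$; $f(t)=t^2$ for $G=B_{2,C}$; $f(t)=e^{\delta t}$ for $G=A_{\delta,C}$; $f(t)=\chi_{[\lambda,\infty)}(t)$ for $G=D_{\lambda,C}$. **Auxiliary functions.** $\xi^\pm=\xi^\pm(C)$ are the two solutions of $e^{-\xi}=C(1-\xi)$ with $-\infty<\xi^-<0<\xi^+<1$. The functions $u^\pm=u^\pm(x)$ on $\Omega_C$ are defined implicitly by $$x_2=e^{u^\pm}\Big(\frac{x_1-u^\pm}{1-\xi^\pm}+1\Big),\qquad x_1-\xi^+\le u^+\le x_1,\qquad x_1\le u^-\le x_1-\xi^-.$$ **Candidates.** For $p\in(1,2]$: $$b_{p,C}(x)=\frac p{\xi^+}\,e^{u^+/\xi^+}\Big[\int_{u^+}^\infty|s|^{p-1}\operatorname{sgn}(s)\,e^{-s/\xi^+}ds\Big](x_1-u^+)+|u^+|^p.$$ $$B_{2,C}(x)=2u^-x_1-(u^-)^2+2\xi^-(x_1-u^-).$$ $b_{1,C}$: write $\Omega_C=\Omega_-\cup\Omega_0\cup\Omega_+$ with $\Omega_-=\{x_1\le\xi^-,\ e^{x_1}\le x_2\le Ce^{x_1}\}\cup\{\xi^-\le x_1\le0,\ e^{x_1}\le x_2\le Ce^{\xi^-}x_1+1\}$, $\Omega_0=\{\xi^-\le x_1\le0,\ Ce^{\xi^-}x_1+1\le x_2\le Ce^{x_1}\}\cup\{0\le x_1\le\xi^+,\ Ce^{\xi^+}x_1+1\le x_2\le Ce^{x_1}\}$, $\Omega_+=\{0\le x_1\le\xi^+,\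 e^{x_1}\le x_2\le Ce^{\xi^+}x_1+1\}\cup\{x_1\ge\xi^+,\ e^{x_1}\le x_2\le Ce^{x_1}\}$. Then $b_{1,C}(x)=-x_1$ on $\Omega_-$, $b_{1,C}(x)=x_1$ on $\Omega_+$, and on $\Omega_0$ $$b_{1,C}(x)=2\,\frac{(1-\xi^-)(1-\xi^+)}{\xi^+-\xi^-}\,(x_2-1)+\frac{\xi^++\xi^--2}{\xi^+-\xi^-}\,x_1.$$ For $1\le\delta<1/\xi^+$: $$A_{\delta,C}(x)=e^{\delta u^+}\Big(\frac{\delta}{1-\delta\xi^+}(x_1-u^+)+1\Big).$$ $D_{\lambda,C}$: write $\Omega_C=\bigcup_{k=1}^4\Omega_k(\lambda)$ with $\Omega_1(\lambda)=\{x_1\le\lambda+\xi^--\xi^+,\ e^{x_1}\le x_2\le Ce^{x_1}\}\cup\{\lambda+\xi^--\xi^+\le x_1\le\lambda+\xi^-,\ e^\lambda(Ce^{\xi^-}(x_1-\lambda)+1)\le x_2\le Ce^{x_1}\}$, $\Omega_2(\lambda)=\{\lambda+\xi^--\xi^+\le x_1<\lambda,\ e^{x_1}\le x_2\le e^\lambda(Ce^{\xi^-}(x_1-\lambda)+1)\}$, $\Omega_3(\lambda)=\{\lambda+\xi^-\le x_1\le\lambda,\ e^\lambda(Ce^{\xi^-}(x_1-\lambda)+1)\le x_2\le Ce^{x_1}\}\cup\{\lambda\le x_1\le\lambda+\xi^+,\ e^\lambda(Ce^{\xi^+}(x_1-\lambda)+1)\le x_2\le Ce^{x_1}\}$, $\Omega_4(\lambda)=\{\lambda\le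 x_1\le\lambda+\xi^+,\ e^{x_1}\le x_2\le e^\lambda(Ce^{\xi^+}(x_1-\lambda)+1)\}\cup\{x_1\ge\lambda+\xi^+,\ e^{x_1}\le x_2\le Ce^{x_1}\}$. For $x\in\Omega_2(\lambda)$ let $v=v(x)<\lambda$ be the horizontal coordinate of the second point where the line through $(\lambda,e^\lambda)$ and $x$ meets the curve $x_2=e^{x_1}$, i.e. $\frac{e^v-e^\lambda}{v-\lambda}=\frac{x_2-e^\lambda}{x_1-\lambda}$. Then $$D_{\lambda,C}(x)=\begin{cases}1,&x\in\Omega_4(\lambda),\\ \frac{1-\xi^-}{(\xi^+-\xi^-)^2}\big[x_1-\lambda+(1-x_2e^{-\lambda})(1-\xi^+)\big]+1,&x\in\Omega_3(\lambda),\\ \frac{x_1-v}{\lambda-v},&x\in\Omega_2(\lambda),\\ \frac{1}{\xi^+-\xi^-}\,e^{(\xi^+-\xi^-+u^+-\lambda)/\xi^+}\,(x_1-u^+),&x\in\Omega_1(\lambda).\end{cases}$$ **The functions $\varphi_x^\pm,\psi_x,\eta_x$ on $Q=(0,1)$** (defined up to null sets; definitions agree a.e. where subdomains overlap). For $x\in\Omega_C$, $$\varphi^\pm_x(t)=u^\pm+\xi^\pm\log\big(\tfrac{\alpha^\pm}t\big)\chi_{(0,\alpha^\pm)}(t),\qquad\alpha^\pm=\frac{x_1-u^\pm}{\xi^\pm}$$ (the second term is $0$ if $\alpha^\pm=0$). $\psi_x$: for $x\in\Omega_+$, $\psi_x=u^++(\xi^+-\xi^-)\chi_{(0,\beta^+)}$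 with $\beta^+=\frac{x_1-u^+}{\xi^+-\xi^-}$; for $x\in\Omega_-$, $\psi_x=u^--(\xi^+-\xi^-)\chi_{(1-\beta^-,1)}$ with $\beta^-=\frac{u^--x_1}{\xi^+-\xi^-}$; for $x\in\Omega_0$, $\psi_x=(\xi^+-\xi^-)\big(\chi_{(0,\gamma^+)}-\chi_{(1-\gamma^-,1)}\big)$ with $$\gamma^\pm=\frac{(x_2-1)(1-\xi^-)(1-\xi^+)-x_1(1-\xi^\pm)}{(\xi^+-\xi^-)^2}.$$ $\eta_x$ (depending on $\lambda$): for $x\in\Omega_3(\lambda)\cup\Omega_4(\lambda)$, $\eta_x=\lambda+\psi_{(x_1-\lambda,\,x_2e^{-\lambda})}$ (the point $(x_1-\lambda,x_2e^{-\lambda})$ lies in $\Omega_0$ if $x\in\Omega_3(\lambda)$ and in $\Omega_+$ if $x\in\Omega_4(\lambda)$); for $x\in\Omega_2(\lambda)$, $\eta_x=\lambda\chi_{(0,\mu)}+v\chi_{(\mu,1)}$ with $\mu=\frac{x_1-v}{\lambda-v}$; for $x\in\Omega_1(\lambda)$, $$\eta_x=\lambda\chi_{(0,\tau\beta^+)}+(\lambda+\xi^--\xi^+)\chi_{(\tau\beta^+,\tau\alpha^+)}+\varphi_x^+\chi_{(\tau\alpha^+,1)},\quad\tau=e^{(u^++\xi^+-\xi^--\lambda)/\xi^+},\ \beta^+=\frac{x_1-u^+}{\xi^+-\xi^-},\ \alpha^+=\frac{x_1-u^+}{\xi^+}.$$ *)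

theory Defs
  imports "HOL-Analysis.Analysis"
begin

abbreviation Q :: "real set" where "Q \<equiv> {0<..<1}"

definition avg :: "real set \<Rightarrow> (real \<Rightarrow> real) \<Rightarrow> real" where
  "avg J \<phi> = (LINT t:J|lebesgue. \<phi> t) / measure lebesgue J"

(* The Bochner integral of a non-integrable function is 0 by convention, so this has its usual
   meaning only when w and ln w are integrable over the subintervals of Q; the class E below,
   the only place where the characteristic is used, includes that integrability.  The supremum is
   taken in the extended reals, so that it is correct for unbounded families. *)
definition A_infty_char :: "(real \<Rightarrow> real) \<Rightarrow> ereal" where
  "A_infty_char w =
     (SUP J \<in> {J. is_interval J \<and> J \<subseteq> Q \<and> 0 < measure lebesgue J}.
        ereal (avg J w * exp (- avg J (\<lambda>t. ln (w t)))))"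

definition \<Omega> :: "real \<Rightarrow> (real \<times> real) set" where
  "\<Omega> C = {(x1, x2). exp x1 \<le> x2 \<and> x2 \<le> C * exp x1}"

definition E :: "real \<Rightarrow> real \<times> real \<Rightarrow> (real \<Rightarrow> real) set" where
  "E C x = {\<phi>. \<phi> absolutely_integrable_on Q \<and> (\<lambda>t. exp (\<phi> t)) absolutely_integrable_on Q \<and>
     avg Q \<phi> = fst x \<and> avg Q (\<lambda>t. exp (\<phi> t)) = snd x \<and>
     A_infty_char (\<lambda>t. exp (\<phi> t)) \<le> ereal C}"

definition optimizer ::
  "real \<Rightarrow> (real \<Rightarrow> real) \<Rightarrow> (real \<times> real \<Rightarrow> real) \<Rightarrow> real \<times> real \<Rightarrow> (real \<Rightarrow> real) \<Rightarrow> bool" where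
  "optimizer C f G x \<phi> \<longleftrightarrow> \<phi> \<in> E C x \<and>
     (\<lambda>t. f (\<phi> t)) absolutely_integrable_on Q \<and> avg Q (\<lambda>t. f (\<phi> t)) = G x"

definition \<xi>p :: "real \<Rightarrow> real" where
  "\<xi>p C = (THE \<xi>. 0 < \<xi> \<and> \<xi> < 1 \<and> exp (- \<xi>) = C * (1 - \<xi>))"

definition \<xi>m :: "real \<Rightarrow> real" where
  "\<xi>m C = (THE \<xi>. \<xi> < 0 \<and> exp (- \<xi>) = C * (1 - \<xi>))"

definition up :: "real \<Rightarrow> real \<times> real \<Rightarrow> real" where
  "up C x = (THE u. fst x - \<xi>p C \<le> u \<and> u \<le> fst x \<and>
     snd x = exp u * ((fst x - u) / (1 - \<xi>p C) + 1))"

definition um :: "real \<Rightarrow> real \<times> real \<Rightarrow> real" where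
  "um C x = (THE u. fst x \<le> u \<and> u \<le> fst x - \<xi>m C \<and>
     snd x = exp u * ((fst x - u) / (1 - \<xi>m C) + 1))"

(* For 1 < p \<le> 2; the case p = 1 is b1_cand. *)
definition b_cand :: "real \<Rightarrow> real \<Rightarrow> real \<times> real \<Rightarrow> real" where
  "b_cand p C x =
     p / \<xi>p C * exp (up C x / \<xi>p C) *
       (LINT s:{up C x<..}|lebesgue. \<bar>s\<bar> powr (p - 1) * sgn s * exp (- s / \<xi>p C)) *
       (fst x - up C x) + \<bar>up C x\<bar> powr p"

definition B2_cand :: "real \<Rightarrow> real \<times> real \<Rightarrow> real" where
  "B2_cand C x = 2 * um C x * fst x - (um C x)^2 + 2 * \<xi>m C * (fst x - um C x)"

definition \<Omega>_minus :: "real \<Rightarrow> (real \<times> real) set" where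
  "\<Omega>_minus C =
     {(x1, x2). x1 \<le> \<xi>m C \<and> exp x1 \<le> x2 \<and> x2 \<le> C * exp x1} \<union>
     {(x1, x2). \<xi>m C \<le> x1 \<and> x1 \<le> 0 \<and> exp x1 \<le> x2 \<and> x2 \<le> C * exp (\<xi>m C) * x1 + 1}"

definition \<Omega>_zero :: "real \<Rightarrow> (real \<times> real) set" where
  "\<Omega>_zero C =
     {(x1, x2). \<xi>m C \<le> x1 \<and> x1 \<le> 0 \<and> C * exp (\<xi>m C) * x1 + 1 \<le> x2 \<and> x2 \<le> C * exp x1} \<union>
     {(x1, x2). 0 \<le> x1 \<and> x1 \<le> \<xi>p C \<and> C * exp (\<xi>p C) * x1 + 1 \<le> x2 \<and> x2 \<le> C * exp x1}"

definition \<Omega>_plus :: "real \<Rightarrow> (real \<times> real) set" where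
  "\<Omega>_plus C =
     {(x1, x2). 0 \<le> x1 \<and> x1 \<le> \<xi>p C \<and> exp x1 \<le> x2 \<and> x2 \<le> C * exp (\<xi>p C) * x1 + 1} \<union>
     {(x1, x2). \<xi>p C \<le> x1 \<and> exp x1 \<le> x2 \<and> x2 \<le> C * exp x1}"

(* In the piecewise definitions below the subdomains cover \<Omega> C, so the final else branch is the
   remaining subdomain.  The subdomains overlap only along common boundaries, where the formulas
   for the candidates agree and those for \<psi> and \<eta> agree almost everywhere; the order of the
   branches is immaterial. *)

definition b1_cand :: "real \<Rightarrow> real \<times> real \<Rightarrow> real" where
  "b1_cand C x =
     (if x \<in> \<Omega>_minus C then - fst x
      else if x \<in> \<Omega>_plus C then fst x
      else 2 * ((1 - \<xi>m C) * (1 - \<xi>p C) / (\<xi>p C - \<xi>m C)) * (snd x - 1)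
             + (\<xi>p C + \<xi>m C - 2) / (\<xi>p C - \<xi>m C) * fst x)"

(* For 1 \<le> \<delta> < 1 / \<xi>p C. *)
definition A_cand :: "real \<Rightarrow> real \<Rightarrow> real \<times> real \<Rightarrow> real" where
  "A_cand \<delta> C x =
     exp (\<delta> * up C x) * (\<delta> / (1 - \<delta> * \<xi>p C) * (fst x - up C x) + 1)"

definition \<Omega>1 :: "real \<Rightarrow> real \<Rightarrow> (real \<times> real) set" where
  "\<Omega>1 lam C =
     {(x1, x2). x1 \<le> lam + \<xi>m C - \<xi>p C \<and> exp x1 \<le> x2 \<and> x2 \<le> C * exp x1} \<union>
     {(x1, x2). lam + \<xi>m C - \<xi>p C \<le> x1 \<and> x1 \<le> lam + \<xi>m C \<and>
        exp lam * (C * exp (\<xi>m C) * (x1 - lam) + 1) \<le> x2 \<and> x2 \<le> C * exp x1}"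

definition \<Omega>2 :: "real \<Rightarrow> real \<Rightarrow> (real \<times> real) set" where
  "\<Omega>2 lam C =
     {(x1, x2). lam + \<xi>m C - \<xi>p C \<le> x1 \<and> x1 < lam \<and>
        exp x1 \<le> x2 \<and> x2 \<le> exp lam * (C * exp (\<xi>m C) * (x1 - lam) + 1)}"

definition \<Omega>3 :: "real \<Rightarrow> real \<Rightarrow> (real \<times> real) set" where
  "\<Omega>3 lam C =
     {(x1, x2). lam + \<xi>m C \<le> x1 \<and> x1 \<le> lam \<and>
        exp lam * (C * exp (\<xi>m C) * (x1 - lam) + 1) \<le> x2 \<and> x2 \<le> C * exp x1} \<union>
     {(x1, x2). lam \<le> x1 \<and> x1 \<le> lam + \<xi>p C \<and>
        exp lam * (C * exp (\<xi>p C) * (x1 - lam) + 1) \<le> x2 \<and> x2 \<le> C * exp x1}"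

definition \<Omega>4 :: "real \<Rightarrow> real \<Rightarrow> (real \<times> real) set" where
  "\<Omega>4 lam C =
     {(x1, x2). lam \<le> x1 \<and> x1 \<le> lam + \<xi>p C \<and>
        exp x1 \<le> x2 \<and> x2 \<le> exp lam * (C * exp (\<xi>p C) * (x1 - lam) + 1)} \<union>
     {(x1, x2). lam + \<xi>p C \<le> x1 \<and> exp x1 \<le> x2 \<and> x2 \<le> C * exp x1}"

(* Horizontal coordinate of the second point where the line through (lam, exp lam) and x meets the
   graph of exp; meaningful for x in \<Omega>2 lam C. *)
definition v_coord :: "real \<Rightarrow> real \<times> real \<Rightarrow> real" where
  "v_coord lam x =
     (THE v. v < lam \<and> (exp v - exp lam) / (v - lam) = (snd x - exp lam) / (fst x - lam))"

definition D_cand :: "real \<Rightarrow> real \<Rightarrow> real \<times> real \<Rightarrow> real" where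
  "D_cand lam C x =
     (if x \<in> \<Omega>4 lam C then 1
      else if x \<in> \<Omega>3 lam C then
        (1 - \<xi>m C) / (\<xi>p C - \<xi>m C)^2 *
          (fst x - lam + (1 - snd x * exp (- lam)) * (1 - \<xi>p C)) + 1
      else if x \<in> \<Omega>2 lam C then (fst x - v_coord lam x) / (lam - v_coord lam x)
      else 1 / (\<xi>p C - \<xi>m C) * exp ((\<xi>p C - \<xi>m C + up C x - lam) / \<xi>p C) * (fst x - up C x))"

definition \<phi>p :: "real \<Rightarrow> real \<times> real \<Rightarrow> real \<Rightarrow> real" where
  "\<phi>p C x t =
     (let \<alpha> = (fst x - up C x) / \<xi>p C
      in up C x + \<xi>p C * ln (\<alpha> / t) * indicator {0<..<\<alpha>} t)"

definition \<phi>m :: "real \<Rightarrow> real \<times> real \<Rightarrow> real \<Rightarrow> real" where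
  "\<phi>m C x t =
     (let \<alpha> = (fst x - um C x) / \<xi>m C
      in um C x + \<xi>m C * ln (\<alpha> / t) * indicator {0<..<\<alpha>} t)"

definition \<psi> :: "real \<Rightarrow> real \<times> real \<Rightarrow> real \<Rightarrow> real" where
  "\<psi> C x t =
     (let d = \<xi>p C - \<xi>m C in
      if x \<in> \<Omega>_plus C then
        (let \<beta>p = (fst x - up C x) / d in up C x + d * indicator {0<..<\<beta>p} t)
      else if x \<in> \<Omega>_minus C then
        (let \<beta>m = (um C x - fst x) / d in um C x - d * indicator {1 - \<beta>m<..<1} t)
      else
        (let \<gamma>p = ((snd x - 1) * (1 - \<xi>m C) * (1 - \<xi>p C) - fst x * (1 - \<xi>p C)) / d^2;
             \<gamma>m = ((snd x - 1) * (1 - \<xi>m C) * (1 - \<xi>p C) - fst x * (1 - \<xi>m C)) / d^2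
         in d * (indicator {0<..<\<gamma>p} t - indicator {1 - \<gamma>m<..<1} t)))"

definition \<eta> :: "real \<Rightarrow> real \<Rightarrow> real \<times> real \<Rightarrow> real \<Rightarrow> real" where
  "\<eta> lam C x t =
     (if x \<in> \<Omega>3 lam C \<union> \<Omega>4 lam C then lam + \<psi> C (fst x - lam, snd x * exp (- lam)) t
      else if x \<in> \<Omega>2 lam C then
        (let v = v_coord lam x; \<mu> = (fst x - v) / (lam - v)
         in lam * indicator {0<..<\<mu>} t + v * indicator {\<mu><..<1} t)
      else
        (let \<tau> = exp ((up C x + \<xi>p C - \<xi>m C - lam) / \<xi>p C);
             \<beta>p = (fst x - up C x) / (\<xi>p C - \<xi>m C);
             \<alpha>p = (fst x - up C x) / \<xi>p C
         in lam * indicator {0<..<\<tau> * \<beta>p} t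
            + (lam + \<xi>m C - \<xi>p C) * indicator {\<tau> * \<beta>p<..<\<tau> * \<alpha>p} t
            + \<phi>p C x t * indicator {\<tau> * \<alpha>p<..<1} t))"

end

theory Submission
  imports Defs "HOL-Real_Asymp.Real_Asymp"
begin

text \<open>
  The averages are direct computations: on its nonconstant part a logarithmic optimizer is pushed
  forward by t = a exp (- s), so that its averages become integrals against exp (- s) on the half
  line, and the other optimizers are combinations of step functions and logarithms.

  The point is the bound on the characteristic.  Put d = xp - xm.  The chord of the graph of exp
  over [u, u + d] is tangent to the graph of C exp, for every u; it lies above the graph of exp over
  [u, u + d] and below it elsewhere.  Hence an interval J is harmless as soon as, for some u, the
  average of exp g over J is at most the average over J of the chord function composed with g.
  This is so if g oscillates by at most d on J.  Let g be monotone, J = (a, b), with an oscillation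
  larger than d, and let the chord have g b as an endpoint.  Then g lies outside the range of the
  chord on (0, a), so the inequality on J follows from the one on (0, b), which for the optimizers
  is an equality or trivial.

  The only function to escape this argument takes three values - d, 0, d.  There J is obtained from
  (0, 1) by cutting off parts of the two end pieces, and cutting off a piece of constancy with
  value u moves the pair of averages away from (u, exp u) along a line; this preserves the bound if
  the average of g is at least u + xp or at most u + xm.
\<close>

subsection \<open>Absolutely convergent integrals\<close>

definition has_abs_integral :: "(real \<Rightarrow> real) \<Rightarrow> real \<Rightarrow> real set \<Rightarrow> bool" where
  "has_abs_integral f I S \<longleftrightarrow> f absolutely_integrable_on S \<and> (f has_integral I) S"

lemma has_abs_integralD:
  assumes "has_abs_integral f I S"
  shows "f absolutely_integrable_on S" "(f has_integral I) S" "integral S f = I"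
  using assms by (auto simp: has_abs_integral_def)

lemma has_abs_integral_iff:
  "has_abs_integral f I S \<longleftrightarrow> f absolutely_integrable_on S \<and> integral S f = I"
  unfolding has_abs_integral_def
  using has_integral_iff set_lebesgue_integral_eq_integral(1) by blast

lemma has_abs_integral_unique:
  "has_abs_integral f I S \<Longrightarrow> has_abs_integral f J S \<Longrightarrow> I = J"
  by (auto simp: has_abs_integral_iff)

lemma has_abs_integral_exists:
  "f absolutely_integrable_on S \<Longrightarrow> has_abs_integral f (integral S f) S"
  by (simp add: has_abs_integral_iff)

lemma has_abs_integral_const:
  assumes "a \<le> b"
  shows "has_abs_integral (\<lambda>_. c) (c * (b - a)) {a<..<b}"
proof -
  have "(\<lambda>_. c) absolutely_integrable_on {a<..<b}"
    by (intro absolutely_integrable_on_const) auto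
  moreover have "integral {a<..<b} (\<lambda>_. c) = c * (b - a)"
    using assms by (simp flip: integral_open_interval_real)
  ultimately show ?thesis
    by (simp add: has_abs_integral_iff)
qed

lemma has_abs_integral_add:
  "has_abs_integral f I S \<Longrightarrow> has_abs_integral g J S \<Longrightarrow>
   has_abs_integral (\<lambda>t. f t + g t) (I + J) S"
  by (auto simp: has_abs_integral_def intro: has_integral_add)

lemma has_abs_integral_cmul:
  "has_abs_integral f I S \<Longrightarrow> has_abs_integral (\<lambda>t. c * f t) (c * I) S"
  by (auto simp: has_abs_integral_def intro: has_integral_mult_right)

lemma has_abs_integral_spike:
  assumes f: "has_abs_integral f I S" and N: "negligible N" "\<And>t. t \<in> S - N \<Longrightarrow> g t = f t"
  shows "has_abs_integral g I S"
  using absolutely_integrable_spike[OF has_abs_integralD(1)[OF f] N]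
    has_integral_spike[OF N has_abs_integralD(2)[OF f]]
  by (simp add: has_abs_integral_def)

lemma has_abs_integral_cong:
  assumes "has_abs_integral f I S" "\<And>t. t \<in> S \<Longrightarrow> g t = f t" "J = I"
  shows "has_abs_integral g J S"
  using has_abs_integral_spike[OF assms(1), of "{}" g] assms(2,3) by simp

lemma has_abs_integral_affine:
  assumes "has_abs_integral f I {a<..<b}" "a \<le> b"
  shows "has_abs_integral (\<lambda>t. p + q * f t) (p * (b - a) + q * I) {a<..<b}"
  by (intro has_abs_integral_add has_abs_integral_const has_abs_integral_cmul assms)

lemma has_abs_integral_spike_set:
  assumes "has_abs_integral f I S" "negligible (S - T)" "negligible (T - S)"
  shows "has_abs_integral f I T"
proof -
  have neg: "negligible {x \<in> S - T. f x \<noteq> 0}" "negligible {x \<in> T - S. f x \<noteq> 0}"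
    using assms by (auto intro: negligible_subset)
  then have "f absolutely_integrable_on T"
    using absolutely_integrable_spike_set_eq[OF neg] assms(1) by (simp add: has_abs_integral_def)
  moreover have "(f has_integral I) T"
    using has_integral_spike_set_eq[OF neg] assms(1) by (simp add: has_abs_integral_def)
  ultimately show ?thesis
    by (simp add: has_abs_integral_def)
qed

lemma has_abs_integral_combine:
  assumes "has_abs_integral f I {a<..<b}" "has_abs_integral f J {b<..<c}" "a \<le> b" "b \<le> c"
  shows "has_abs_integral f (I + J) {a<..<c}"
proof (rule has_abs_integral_spike_set[of _ _ "{a<..<b} \<union> {b<..<c}"])
  have "{a<..<b} \<inter> {b<..<c} = {}" by auto
  then show "has_abs_integral f (I + J) ({a<..<b} \<union> {b<..<c})"
    using assms unfolding has_abs_integral_def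
    by (intro conjI set_integrable_Un has_integral_Un) auto
  show "negligible ({a<..<c} - ({a<..<b} \<union> {b<..<c}))"
    by (rule negligible_subset[of "{b}"]) auto
  show "negligible (({a<..<b} \<union> {b<..<c}) - {a<..<c})"
    by (rule negligible_subset[of "{}"]) (use assms in auto)
qed

lemma has_abs_integral_split:
  assumes "has_abs_integral f I {a<..<c}" "a \<le> b" "b \<le> c"
  obtains J K where "has_abs_integral f J {a<..<b}" "has_abs_integral f K {b<..<c}" "I = J + K"
proof -
  have "f absolutely_integrable_on {a<..<b}" "f absolutely_integrable_on {b<..<c}"
    using assms by (auto intro: set_integrable_subset[OF has_abs_integralD(1)[OF assms(1)]])
  note * = this[THEN has_abs_integral_exists]
  show ?thesis
    using * has_abs_integral_unique[OF assms(1) has_abs_integral_combine[OF * assms(2,3)]] that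
    by blast
qed

lemma has_abs_integral_mono:
  assumes "has_abs_integral f I S" "has_abs_integral g J S" "\<And>t. t \<in> S \<Longrightarrow> f t \<le> g t"
  shows "I \<le> J"
  using assms has_integral_le[of f I S g J] by (auto simp: has_abs_integral_def)

lemma avg_interval:
  assumes "has_abs_integral f I {a<..<b}" "a < b"
  shows "avg {a<..<b} f = I / (b - a)"
  using assms has_abs_integralD[OF assms(1)] set_lebesgue_integral_eq_integral(2)[of "{a<..<b}" f]
  by (simp add: avg_def)

text \<open>Vanishes beyond a; for a = 0 it is 0 everywhere because ln 0 = 0.\<close>

definition tlog :: "real \<Rightarrow> real \<Rightarrow> real" where
  "tlog a t = max 0 (ln (a / t))"

lemma tlog_simps:
  "0 < t \<Longrightarrow> t \<le> a \<Longrightarrow> tlog a t = ln (a / t)"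
  "0 \<le> a \<Longrightarrow> a \<le> t \<Longrightarrow> tlog a t = 0"
   apply (simp add: tlog_def)
  by (cases "a = 0") (auto simp: tlog_def divide_simps intro!: max_absorb1)

lemma has_abs_integral_tlog:
  assumes F: "has_abs_integral (\<lambda>s. F s * exp (- s)) I {0<..}" and "0 \<le> \<alpha>" "\<alpha> \<le> b"
  shows "has_abs_integral (\<lambda>t. F (tlog \<alpha> t)) (\<alpha> * I + (b - \<alpha>) * F 0) {0<..<b}"
proof (rule has_abs_integral_combine)
  show "has_abs_integral (\<lambda>t. F (tlog \<alpha> t)) ((b - \<alpha>) * F 0) {\<alpha><..<b}"
    by (rule has_abs_integral_cong[OF has_abs_integral_const[of \<alpha> b "F 0"]])
       (use assms in \<open>auto simp: tlog_simps\<close>)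
  show "has_abs_integral (\<lambda>t. F (tlog \<alpha> t)) (\<alpha> * I) {0<..<\<alpha>}"
  proof (cases "\<alpha> = 0")
    case True
    then show ?thesis using has_abs_integral_const[of 0 0]  by (simp add: has_abs_integral_def)
  next
    case False
    with assms have \<alpha>: "\<alpha> > 0" by simp
    let ?g = "\<lambda>s. \<alpha> * exp (- s)"
    have img: "?g ` {0<..} = {0<..<\<alpha>}"
    proof safe
      fix t assume "t \<in> {0<..<\<alpha>}"
      then have "t = ?g (ln (\<alpha> / t))" "ln (\<alpha> / t) > 0"
        using \<alpha> by (auto simp: exp_minus divide_simps)
      then show "t \<in> ?g ` {0<..}" by blast
    qed (use \<alpha> in auto)
    have "has_abs_integral (\<lambda>s. \<bar>- \<alpha> * exp (- s)\<bar> * F (tlog \<alpha> (?g s))) (\<alpha> * I) {0<..}"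
    proof (rule has_abs_integral_cong[OF has_abs_integral_cmul[OF F, of \<alpha>]])
      fix s :: real assume "s \<in> {0<..}"
      then have "tlog \<alpha> (?g s) = s"
        using \<alpha> by (auto simp: tlog_simps ln_div exp_minus field_simps)
      then show "\<bar>- \<alpha> * exp (- s)\<bar> * F (tlog \<alpha> (?g s)) = \<alpha> * (F s * exp (- s))"
        using \<alpha> by (simp add: abs_mult)
    qed simp
    moreover have "(?g has_field_derivative - \<alpha> * exp (- s)) (at s within {0<..})" for s
      by (auto intro!: derivative_eq_intros)
    moreover have "inj_on ?g {0<..}"
      using \<alpha> by (auto simp: inj_on_def)
    ultimately show ?thesis
      using has_absolute_integral_change_of_variables_1'[of "{0<..}" ?g "\<lambda>s. - \<alpha> * exp (- s)"
          "\<lambda>t. F (tlog \<alpha> t)" "\<alpha> * I"]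
      by (simp add: img has_abs_integral_iff)
  qed
qed (use assms in auto)

lemma has_abs_integral_Ioi_iff:
  "has_abs_integral f I {c<..} \<longleftrightarrow> has_abs_integral f I {c..}"
proof -
  have neg: "negligible ({c..} - {c<..})" "negligible ({c<..} - {c..})"
    by (rule negligible_subset[of "{c}"]; auto)+
  then show ?thesis
    by (auto intro: has_abs_integral_spike_set)
qed

lemma has_abs_integral_nonneg:
  assumes "(f has_integral I) S" "\<And>t. t \<in> S \<Longrightarrow> 0 \<le> f t"
  shows "has_abs_integral f I S"
  using assms nonnegative_absolutely_integrable_1[of f S] by (auto simp: has_abs_integral_def has_integral_iff)

lemma has_abs_integral_exp:
  assumes "k < 1"
  shows "has_abs_integral (\<lambda>s. exp (k * s) * exp (- s)) (1 / (1 - k)) {0<..}"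
proof -
  have "((\<lambda>s. exp (- (1 - k) * s)) has_integral exp (- (1 - k) * 0) / (1 - k)) {0..}"
    using assms by (intro has_integral_exp_minus_to_infinity) auto
  moreover have "(\<lambda>s. exp (- (1 - k) * s)) = (\<lambda>s. exp (k * s) * exp (- s))"
    by (simp flip: exp_add add: algebra_simps)
  ultimately show ?thesis
    unfolding has_abs_integral_Ioi_iff by (intro has_abs_integral_nonneg) auto
qed

lemma has_abs_integral_power:
  "has_abs_integral (\<lambda>s. s ^ n * exp (- s)) (fact n) {0<..}"
proof -
  have "((\<lambda>t. t powr (real (Suc n) - 1) / exp t) has_integral Gamma (real (Suc n))) {0..}"
    by (intro Gamma_integral_real) auto
  then have "has_abs_integral (\<lambda>t. t powr (real (Suc n) - 1) / exp t) (fact n) {0<..}"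
    unfolding has_abs_integral_Ioi_iff
    by (intro has_abs_integral_nonneg) (auto simp: Gamma_fact add.commute)
  then show ?thesis
    by (rule has_abs_integral_cong) (auto simp: powr_realpow exp_minus divide_simps)
qed

lemma absolutely_integrable_quadratic_growth:
  fixes h :: "real \<Rightarrow> real"
  assumes h: "h \<in> borel_measurable borel" and bound: "\<And>s. \<bar>h s\<bar> \<le> M + N * s\<^sup>2"
  shows "(\<lambda>s. h s * exp (- s)) absolutely_integrable_on {0<..}"
proof (rule measurable_bounded_by_integrable_imp_absolutely_integrable)
  have "(\<lambda>s. h s * exp (- s)) \<in> borel_measurable borel"
    using h by measurable
  then show "(\<lambda>s. h s * exp (- s)) \<in> borel_measurable (lebesgue_on {0<..})"
    by (intro measurable_restrict_space1 measurable_completion) simp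
  have "has_abs_integral (\<lambda>s. M * (s ^ 0 * exp (- s)) + N * (s ^ 2 * exp (- s)))
          (M * fact 0 + N * fact 2) {0<..}"
    by (intro has_abs_integral_add has_abs_integral_cmul has_abs_integral_power)
  then have "has_abs_integral (\<lambda>s. (M + N * s\<^sup>2) * exp (- s)) (M * fact 0 + N * fact 2) {0<..}"
    by (rule has_abs_integral_cong) (simp_all add: algebra_simps)
  then show "(\<lambda>s. (M + N * s\<^sup>2) * exp (- s)) integrable_on {0<..}"
    by (auto simp: has_abs_integral_def)
  show "norm (h s * exp (- s)) \<le> (M + N * s\<^sup>2) * exp (- s)" for s
    using bound[of s] by (simp add: abs_mult)
qed simp

lemma powr_le_1_plus_square:
  fixes y p :: real
  assumes "0 \<le> p" "p \<le> 2"
  shows "\<bar>y\<bar> powr p \<le> 1 + y\<^sup>2"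
proof (cases "\<bar>y\<bar> \<le> 1")
  case True
  then have "\<bar>y\<bar> powr p \<le> 1"
    using assms by (intro powr_le1) auto
  then show ?thesis by (smt (verit) zero_le_power2)
next
  case False
  then have "\<bar>y\<bar> powr p \<le> \<bar>y\<bar> powr 2"
    using assms by (intro powr_mono) auto
  also have "\<dots> = y\<^sup>2"
    using False by (subst powr_numeral) auto
  finally show ?thesis by simp
qed

lemma square_affine_le: "(u + \<xi> * s)\<^sup>2 \<le> 2 * u\<^sup>2 + 2 * \<xi>\<^sup>2 * (s::real)\<^sup>2"
  using zero_le_power2[of "u - \<xi> * s"] by (simp add: power2_eq_square algebra_simps)

lemma has_real_derivative_abs_powr:
  fixes y p :: real
  assumes "y \<noteq> 0"
  shows "((\<lambda>y. \<bar>y\<bar> powr p) has_real_derivative p * \<bar>y\<bar> powr (p - 1) * sgn y) (at y)"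
proof (cases "y > 0")
  case True
  have "((\<lambda>y. y powr p) has_real_derivative p * y powr (p - 1)) (at y)"
    using True by (rule has_real_derivative_powr)
  then have "((\<lambda>y. \<bar>y\<bar> powr p) has_real_derivative p * y powr (p - 1)) (at y)"
    by (rule has_field_derivative_transform_within_open[where S = "{0<..}"]) (use True in auto)
  then show ?thesis using True by simp
next
  case False
  with assms have "y < 0" by simp
  then have "((\<lambda>y. (- y) powr p) has_real_derivative - (p * (- y) powr (p - 1))) (at y)"
    by (auto intro!: derivative_eq_intros simp: powr_diff)
  then have "((\<lambda>y. \<bar>y\<bar> powr p) has_real_derivative - (p * (- y) powr (p - 1))) (at y)"
    by (rule has_field_derivative_transform_within_open[where S = "{..<0}"]) (use \<open>y < 0\<close> in auto)
  then show ?thesis using \<open>y < 0\<close> by simp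
qed

lemma has_abs_integral_abs_powr:
  fixes u \<xi> p :: real
  assumes "1 < p" "p \<le> 2" "0 < \<xi>"
  defines "K \<equiv> integral {0<..} (\<lambda>s. (\<bar>u + \<xi> * s\<bar> powr (p - 1) * sgn (u + \<xi> * s)) * exp (- s))"
  shows "has_abs_integral (\<lambda>s. \<bar>u + \<xi> * s\<bar> powr p * exp (- s)) (\<bar>u\<bar> powr p + p * \<xi> * K) {0<..}"
    and "has_abs_integral (\<lambda>s. (\<bar>u + \<xi> * s\<bar> powr (p - 1) * sgn (u + \<xi> * s)) * exp (- s)) K {0<..}"
proof -
  let ?h = "\<lambda>s. \<bar>u + \<xi> * s\<bar> powr p"
  let ?k = "\<lambda>s. \<bar>u + \<xi> * s\<bar> powr (p - 1) * sgn (u + \<xi> * s)"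
  let ?M = "1 + 2 * u\<^sup>2" and ?N = "2 * \<xi>\<^sup>2"
  have hbound: "\<bar>?h s\<bar> \<le> ?M + ?N * s\<^sup>2" for s
    using powr_le_1_plus_square[of p "u + \<xi> * s"] square_affine_le[of u \<xi> s] assms by simp
  have hM: "?h \<in> borel_measurable borel" "?k \<in> borel_measurable borel"
    by measurable
  have kbound: "\<bar>?k s\<bar> \<le> ?M + ?N * s\<^sup>2" for s
  proof -
    have "\<bar>?k s\<bar> \<le> \<bar>u + \<xi> * s\<bar> powr (p - 1)"
      by (simp add: abs_mult sgn_if)
    also have "\<dots> \<le> 1 + (u + \<xi> * s)\<^sup>2"
      using assms by (intro powr_le_1_plus_square) auto
    finally show ?thesis using square_affine_le[of u \<xi> s] by simp
  qed
  define H where "H = integral {0<..} (\<lambda>s. ?h s * exp (- s))"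
  have h: "has_abs_integral (\<lambda>s. ?h s * exp (- s)) H {0<..}"
    unfolding H_def
    by (intro has_abs_integral_exists absolutely_integrable_quadratic_growth[OF hM(1) hbound])
  show k: "has_abs_integral (\<lambda>s. ?k s * exp (- s)) K {0<..}"
    unfolding K_def
    by (intro has_abs_integral_exists absolutely_integrable_quadratic_growth[OF hM(2) kbound])
  let ?F = "\<lambda>s. ?h s * exp (- s)"
  let ?F' = "\<lambda>s. p * \<xi> * (?k s * exp (- s)) + (- 1) * (?h s * exp (- s))"
  have F': "has_abs_integral ?F' (p * \<xi> * K + (- 1) * H) {0..}"
    unfolding has_abs_integral_Ioi_iff[symmetric]
    by (intro has_abs_integral_add has_abs_integral_cmul h k)
  have ftc: "(?F' has_integral ?F b - ?F 0) {0..b}" if "0 \<le> b" for b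
  proof (rule fundamental_theorem_of_calculus_interior_strong[of "{- u / \<xi>}"])
    fix s assume "s \<in> {0<..<b} - {- u / \<xi>}"
    then have "u + \<xi> * s \<noteq> 0"
      using \<open>0 < \<xi>\<close> by (auto simp: field_simps)
    have "(?h has_real_derivative (p * \<bar>u + \<xi> * s\<bar> powr (p - 1) * sgn (u + \<xi> * s)) * \<xi>) (at s)"
      by (rule DERIV_chain2[where f = "\<lambda>y. \<bar>y\<bar> powr p" and g = "\<lambda>s. u + \<xi> * s",
            OF has_real_derivative_abs_powr[OF \<open>u + \<xi> * s \<noteq> 0\<close>]])
         (auto intro!: derivative_eq_intros)
    moreover have "((\<lambda>s. exp (- s)) has_real_derivative - exp (- s)) (at s)"
      by (auto intro!: derivative_eq_intros)
    ultimately have "(?F has_real_derivative ?F' s) (at s)"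
      by (rule DERIV_cong[OF DERIV_mult]) (simp add: algebra_simps)
    then show "(?F has_vector_derivative ?F' s) (at s)"
      by (simp add: has_real_derivative_iff_has_vector_derivative)
  next
    show "continuous_on {0..b} ?F"
      using assms by (intro continuous_intros continuous_on_powr') auto
  qed (use that in auto)
  have sub: "?F' absolutely_integrable_on {0..b}" for b
    using has_abs_integralD(1)[OF F'] by (rule set_integrable_subset) auto
  have "((\<lambda>b. LINT s:{0..b}|lebesgue. ?F' s) \<longlongrightarrow> (LINT s:{0..}|lebesgue. ?F' s)) at_top"
    by (intro tendsto_set_lebesgue_integral_at_top has_abs_integralD(1)[OF F']) auto
  then have "((\<lambda>b. integral {0..b} ?F') \<longlongrightarrow> p * \<xi> * K + (- 1) * H) at_top"
    using set_lebesgue_integral_eq_integral(2)[OF sub]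
      set_lebesgue_integral_eq_integral(2)[OF has_abs_integralD(1)[OF F']] has_abs_integralD(3)[OF F']
    by simp
  moreover have "((\<lambda>b. integral {0..b} ?F') \<longlongrightarrow> - (\<bar>u\<bar> powr p)) at_top"
  proof -
    have "((\<lambda>b::real. (?M + ?N * b\<^sup>2) * exp (- b)) \<longlongrightarrow> 0) at_top"
      by real_asymp
    then have "(?F \<longlongrightarrow> 0) at_top"
      by (rule Lim_null_comparison[rotated]) (use hbound in \<open>auto simp: abs_mult\<close>)
    then have "((\<lambda>b. ?F b - ?F 0) \<longlongrightarrow> 0 - ?F 0) at_top"
      by (intro tendsto_diff) auto
    moreover have "\<forall>\<^sub>F b in at_top. ?F b - ?F 0 = integral {0..b} ?F'"
      using eventually_ge_at_top[of 0]
      by eventually_elim (rule integral_unique[OF ftc, symmetric])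
    ultimately show ?thesis
      by (simp add: filterlim_cong)
  qed
  ultimately have "p * \<xi> * K + (- 1) * H = - (\<bar>u\<bar> powr p)"
    by (rule tendsto_unique[rotated]) simp
  then show "has_abs_integral (\<lambda>s. \<bar>u + \<xi> * s\<bar> powr p * exp (- s)) (\<bar>u\<bar> powr p + p * \<xi> * K) {0<..}"
    using h by (simp add: algebra_simps)
qed

lemma has_abs_integral_affine_exp_substitution:
  assumes "has_abs_integral (\<lambda>s. F (u + \<xi> * s) * exp (- s)) K {0<..}" "0 < \<xi>"
  shows "has_abs_integral (\<lambda>r. F r * exp (- r / \<xi>)) (\<xi> * exp (- u / \<xi>) * K) {u<..}"
proof -
  let ?g = "\<lambda>s. u + \<xi> * s"
  have img: "?g ` {0<..} = {u<..}"
  proof safe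
    fix r assume "u < r"
    then have "r = ?g ((r - u) / \<xi>)" "(r - u) / \<xi> > 0"
      using assms(2) by (auto simp: field_simps)
    then show "r \<in> ?g ` {0<..}" by blast
  qed (use assms in auto)
  have "has_abs_integral (\<lambda>s. \<bar>\<xi>\<bar> * (F (?g s) * exp (- ?g s / \<xi>))) (\<xi> * exp (- u / \<xi>) * K) {0<..}"
    by (rule has_abs_integral_cong[OF has_abs_integral_cmul[OF assms(1), of "\<xi> * exp (- u / \<xi>)"]])
       (use assms(2) in \<open>auto simp: add_divide_distrib diff_divide_distrib simp flip: exp_add\<close>)
  moreover have "(?g has_field_derivative \<xi>) (at s within {0<..})" for s
    by (auto intro!: derivative_eq_intros)
  moreover have "inj_on ?g {0<..}"
    using assms(2) by (auto simp: inj_on_def)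
  ultimately show ?thesis
    using has_absolute_integral_change_of_variables_1'[of "{0<..}" ?g "\<lambda>_. \<xi>"
        "\<lambda>r. F r * exp (- r / \<xi>)" "\<xi> * exp (- u / \<xi>) * K"]
    by (simp add: img has_abs_integral_iff)
qed

subsection \<open>Tangents to the upper boundary\<close>

lemma exp_gt_add_one:
  fixes x :: real
  assumes "x \<noteq> 0"
  shows "1 + x < exp x"
proof (cases "1 + x / 2 \<ge> 0")
  case True
  have "1 + x < (1 + x / 2)\<^sup>2"
    using assms zero_less_power2[of x] by (simp add: power2_eq_square algebra_simps)
  also have "\<dots> \<le> (exp (x / 2))\<^sup>2"
    using True by (intro power_mono exp_ge_add_one_self)
  finally show ?thesis by (simp add: power2_eq_square flip: exp_add)
next
  case False
  then show ?thesis by (smt (verit) exp_gt_zero field_sum_of_halves)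
qed

lemma exp_strict_convex:
  fixes a b c :: real
  assumes "a < b" "b < c"
  shows "(exp b - exp a) * (c - b) < (exp c - exp b) * (b - a)"
proof -
  have "exp b * (1 + (a - b)) < exp b * exp (a - b)" "exp b * (1 + (c - b)) < exp b * exp (c - b)"
    using assms by (auto intro!: mult_strict_left_mono exp_gt_add_one)
  then have "exp b - exp a < exp b * (b - a)" "exp b * (c - b) < exp c - exp b"
    by (simp_all add: algebra_simps flip: exp_add)
  then have "(exp b - exp a) * (c - b) < exp b * (b - a) * (c - b)"
    and "exp b * (c - b) * (b - a) < (exp c - exp b) * (b - a)"
    using assms by auto
  then show ?thesis by (simp add: mult_ac)
qed

lemma exp_secant:
  fixes d k z :: real
  assumes "0 < d" "exp d = 1 + k * d"
  shows "0 \<le> z \<Longrightarrow> z \<le> d \<Longrightarrow> exp z \<le> 1 + k * z"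
    and "z \<le> 0 \<or> d \<le> z \<Longrightarrow> 1 + k * z \<le> exp z"
proof -
  have "(exp z - 1 - k * z) * d < 0" if "0 < z" "z < d"
    using exp_strict_convex[OF that] assms(2) by (simp add: algebra_simps)
  then show "0 \<le> z \<Longrightarrow> z \<le> d \<Longrightarrow> exp z \<le> 1 + k * z"
    using assms by (cases "z = 0 \<or> z = d") (auto simp: mult_less_0_iff)
  have "(exp z - 1 - k * z) * d > 0" if "d < z"
    using exp_strict_convex[OF assms(1) that] assms(2) by (simp add: algebra_simps)
  moreover have "(exp z - 1 - k * z) * d > 0" if "z < 0"
    using exp_strict_convex[OF that assms(1)] assms(2) by (simp add: algebra_simps)
  ultimately show "z \<le> 0 \<or> d \<le> z \<Longrightarrow> 1 + k * z \<le> exp z"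
    using assms by (cases "z = 0 \<or> z = d") (auto simp: zero_less_mult_iff)
qed

text \<open>For a root \<xi> of exp (- \<xi>) = C (1 - \<xi>) this is, as a function of y, the line through
  (u, exp u) that touches the graph of C exp above u + \<xi>.\<close>

definition tline :: "real \<Rightarrow> real \<Rightarrow> real \<Rightarrow> real" where
  "tline \<xi> u y = exp u * (1 + (y - u) / (1 - \<xi>))"

lemma tline_has_derivative:
  assumes "\<xi> < 1"
  shows "((\<lambda>u. tline \<xi> u y) has_real_derivative exp u * ((y - u) - \<xi>) / (1 - \<xi>)) (at u)"
proof -
  define k where "k = 1 / (1 - \<xi>)"
  have k: "\<xi> * k = k - 1"
    using assms by (simp add: k_def field_simps)
  have "exp u * ((y - u) - \<xi>) / (1 - \<xi>) = exp u * ((y - u) * k - \<xi> * k)"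
    by (simp add: k_def diff_divide_distrib add_divide_distrib algebra_simps)
  also have "\<dots> = exp u * (1 + k * (y - u)) - exp u * k"
    unfolding k by (simp add: algebra_simps)
  finally have "exp u * ((y - u) - \<xi>) / (1 - \<xi>) = exp u * (1 + k * (y - u)) - exp u * k" .
  moreover have "((\<lambda>u. exp u * (1 + k * (y - u))) has_real_derivative
      exp u * (1 + k * (y - u)) - exp u * k) (at u)"
    by (auto intro!: derivative_eq_intros simp: algebra_simps)
  ultimately show ?thesis
    by (simp add: tline_def k_def)
qed

lemma continuous_on_tline: "\<xi> < 1 \<Longrightarrow> continuous_on S (\<lambda>u. tline \<xi> u y)"
  unfolding tline_def by (auto intro!: continuous_intros)

lemma tline_less:
  assumes "\<xi> < 1" "u < u'"
  shows "y - \<xi> \<le> u \<Longrightarrow> tline \<xi> u' y < tline \<xi> u y"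
    and "u' \<le> y - \<xi> \<Longrightarrow> tline \<xi> u y < tline \<xi> u' y"
proof -
  assume *: "y - \<xi> \<le> u"
  show "tline \<xi> u' y < tline \<xi> u y"
  proof (rule DERIV_neg_imp_decreasing_open[OF assms(2)])
    fix v assume "u < v" "v < u'"
    then have "exp v * ((y - v) - \<xi>) / (1 - \<xi>) < 0"
      using * assms by (auto simp: divide_less_0_iff mult_less_0_iff)
    then show "\<exists>z. ((\<lambda>u. tline \<xi> u y) has_real_derivative z) (at v) \<and> z < 0"
      using tline_has_derivative[OF assms(1)] by blast
  qed (rule continuous_on_tline[OF assms(1)])
next
  assume *: "u' \<le> y - \<xi>"
  show "tline \<xi> u y < tline \<xi> u' y"
  proof (rule DERIV_pos_imp_increasing_open[OF assms(2)])
    fix v assume "u < v" "v < u'"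
    then have "0 < exp v * ((y - v) - \<xi>) / (1 - \<xi>)"
      using * assms by (auto simp: zero_less_divide_iff zero_less_mult_iff)
    then show "\<exists>z. ((\<lambda>u. tline \<xi> u y) has_real_derivative z) (at v) \<and> z > 0"
      using tline_has_derivative[OF assms(1)] by blast
  qed (rule continuous_on_tline[OF assms(1)])
qed

lemma tline_0: "tline \<xi> u u = exp u"
  by (simp add: tline_def)

lemma tline_tangent_le:
  assumes "\<xi> < 1" "exp (- \<xi>) = C * (1 - \<xi>)"
  shows "tline \<xi> u y \<le> C * exp y"
proof -
  have "exp (u + \<xi>) * (1 + (y - u - \<xi>)) \<le> exp (u + \<xi>) * exp (y - u - \<xi>)"
    by (intro mult_left_mono exp_ge_add_one_self) auto
  then have *: "exp (u + \<xi>) * (1 + (y - u - \<xi>)) \<le> exp y"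
    by (simp flip: exp_add)
  have C: "C = exp (- \<xi>) / (1 - \<xi>)"
    using assms by (simp add: field_simps)
  have "tline \<xi> u y = C * (exp (u + \<xi>) * (1 + (y - u - \<xi>)))"
    using assms(1) by (simp add: tline_def C exp_add exp_minus field_simps)
  also have "\<dots> \<le> C * exp y"
    using * assms(1) by (intro mult_left_mono) (auto simp: C)
  finally show ?thesis .
qed

lemma tline_tangent_eq:
  assumes "\<xi> < 1" "exp (- \<xi>) = C * (1 - \<xi>)"
  shows "tline \<xi> (y - \<xi>) y = C * exp y"
proof -
  have C: "C = exp (- \<xi>) / (1 - \<xi>)"
    using assms by (simp add: field_simps)
  show ?thesis
    using assms(1) by (simp add: tline_def C exp_diff exp_minus field_simps)
qed

locale A_infty_bound =
  fixes C :: real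
  assumes C_gt_1: "C > 1"
begin

abbreviation "xp \<equiv> \<xi>p C"
abbreviation "xm \<equiv> \<xi>m C"
abbreviation "d \<equiv> xp - xm"

lemma xi_equation_iff: "exp (- \<xi>) = C * (1 - \<xi>) \<longleftrightarrow> tline 0 \<xi> 0 = 1 / C"
  using C_gt_1 by (auto simp: tline_def exp_minus field_simps)

lemma xp: "0 < xp" "xp < 1" "exp (- xp) = C * (1 - xp)"
proof -
  obtain \<xi> where \<xi>: "0 \<le> \<xi>" "\<xi> \<le> 1" "tline 0 \<xi> 0 = 1 / C"
    using IVT2'[of "\<lambda>\<xi>. tline 0 \<xi> 0" 1 "1 / C" 0] C_gt_1 continuous_on_tline[of 0 "{0..1}" 0]
    by (auto simp: tline_def)
  have neq: "\<xi> \<noteq> 0" "\<xi> \<noteq> 1"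
    using \<xi>(3) C_gt_1 by (auto simp: tline_def)
  show "0 < xp" "xp < 1" "exp (- xp) = C * (1 - xp)"
    unfolding \<xi>p_def
    using theI[of "\<lambda>\<xi>. 0 < \<xi> \<and> \<xi> < 1 \<and> exp (- \<xi>) = C * (1 - \<xi>)" \<xi>]
      \<xi> neq tline_less(1)[of 0 _ _ 0] unfolding xi_equation_iff
    by (smt (verit))+
qed

lemma xm: "xm < 0" "exp (- xm) = C * (1 - xm)"
proof -
  have "tline 0 (- 4 * C) 0 \<le> 1 / C"
  proof -
    have "(1 + 2 * C)\<^sup>2 \<le> (exp (2 * C))\<^sup>2"
      using C_gt_1 by (intro power_mono exp_ge_add_one_self) auto
    moreover have "C * (1 + 4 * C) \<le> (1 + 2 * C)\<^sup>2"
      using C_gt_1 by (simp add: power2_eq_square algebra_simps)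
    ultimately have "C * (1 + 4 * C) \<le> exp (4 * C)"
      by (simp add: power2_eq_square flip: exp_add)
    then show ?thesis
      using C_gt_1 by (simp add: tline_def exp_minus field_simps)
  qed
  then obtain \<xi> where \<xi>: "\<xi> \<le> 0" "tline 0 \<xi> 0 = 1 / C"
    using IVT'[of "\<lambda>\<xi>. tline 0 \<xi> 0" "- 4 * C" "1 / C" 0] C_gt_1
      continuous_on_tline[of 0 "{- 4 * C..0}" 0]
    by (auto simp: tline_0)
  have neq: "\<xi> \<noteq> 0"
    using \<xi>(2) C_gt_1 by (auto simp: tline_def)
  show "xm < 0" "exp (- xm) = C * (1 - xm)"
    unfolding \<xi>m_def
    using theI[of "\<lambda>\<xi>. \<xi> < 0 \<and> exp (- \<xi>) = C * (1 - \<xi>)" \<xi>]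
      \<xi> neq tline_less(2)[of 0 _ _ 0] unfolding xi_equation_iff
    by (smt (verit))+
qed

lemma xi_bounds: "0 < xp" "xp < 1" "xm < 0" "xm < 1" "0 < d"
  using xp xm by auto

lemma exp_d: "exp d * (1 - xp) = 1 - xm"
proof -
  have "exp d = exp (- xm) / exp (- xp)"
    by (simp flip: exp_diff)
  also have "\<dots> = (1 - xm) / (1 - xp)"
    using C_gt_1 unfolding xp(3) xm(2) by simp
  finally show ?thesis using xi_bounds by simp
qed

lemma exp_d_eq: "exp d = 1 + 1 / (1 - xp) * d"
  using exp_d xi_bounds by (simp add: field_simps)

lemma tangent_slopes: "C * exp xp = 1 / (1 - xp)" "C * exp xm = 1 / (1 - xm)"
  using xp xm by (simp_all add: exp_minus field_simps)

lemma tline_xm: "tline xm u y = tline xp (u - d) y"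
proof -
  have e: "exp (u - d) = exp u * (1 - xp) / (1 - xm)"
  proof -
    have "exp d = (1 - xm) / (1 - xp)"
      using exp_d xi_bounds by (simp add: field_simps)
    then show ?thesis
      unfolding exp_diff[of u d] by simp
  qed
  show ?thesis
  proof -
    have "1 + (y - (u - d)) / (1 - xp) = (1 - xm + (y - u)) / (1 - xp)"
      and "1 + (y - u) / (1 - xm) = (1 - xm + (y - u)) / (1 - xm)"
      using xi_bounds by (auto simp: field_simps)
    then show ?thesis
      unfolding tline_def e using xi_bounds by simp
  qed
qed

lemma tline_le: "tline xp u y \<le> C * exp y"
  using tline_tangent_le xp by blast

lemma exp_le_tline: "u \<le> y \<Longrightarrow> y \<le> u + d \<Longrightarrow> exp y \<le> tline xp u y"
  and tline_le_exp: "y \<le> u \<or> u + d \<le> y \<Longrightarrow> tline xp u y \<le> exp y"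
proof -
  have *: "exp y = exp u * exp (y - u)" "tline xp u y = exp u * (1 + 1 / (1 - xp) * (y - u))"
    by (simp_all add: tline_def flip: exp_add)
  show "u \<le> y \<Longrightarrow> y \<le> u + d \<Longrightarrow> exp y \<le> tline xp u y"
    unfolding * using exp_secant(1)[OF xi_bounds(5) exp_d_eq, of "y - u"] by simp
  show "y \<le> u \<or> u + d \<le> y \<Longrightarrow> tline xp u y \<le> exp y"
    unfolding * using exp_secant(2)[OF xi_bounds(5) exp_d_eq, of "y - u"] by auto
qed

lemma up:
  assumes "x \<in> \<Omega> C"
  shows "fst x - xp \<le> up C x" "up C x \<le> fst x" "snd x = tline xp (up C x) (fst x)"
proof -
  have x: "exp (fst x) \<le> snd x" "snd x \<le> C * exp (fst x)"
    using assms by (auto simp: \<Omega>_def)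
  obtain u where u: "fst x - xp \<le> u" "u \<le> fst x" "tline xp u (fst x) = snd x"
    using IVT2'[of "\<lambda>u. tline xp u (fst x)" "fst x" "snd x" "fst x - xp"] x xp
      continuous_on_tline[of xp _ "fst x"]
    by (auto simp: tline_0 tline_tangent_eq)
  have eq: "tline xp u (fst x) = exp u * ((fst x - u) / (1 - xp) + 1)" for u
    by (simp add: tline_def)
  show "fst x - xp \<le> up C x" "up C x \<le> fst x" "snd x = tline xp (up C x) (fst x)"
    unfolding up_def
    using theI[of "\<lambda>u. fst x - xp \<le> u \<and> u \<le> fst x \<and> snd x = tline xp u (fst x)" u]
      u tline_less(1)[OF xp(2), of _ _ "fst x"] unfolding eq
    by (smt (verit))+
qed

lemma um:
  assumes "x \<in> \<Omega> C"
  shows "fst x \<le> um C x" "um C x \<le> fst x - xm" "snd x = tline xm (um C x) (fst x)"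
proof -
  have x: "exp (fst x) \<le> snd x" "snd x \<le> C * exp (fst x)"
    using assms by (auto simp: \<Omega>_def)
  obtain u where u: "fst x \<le> u" "u \<le> fst x - xm" "tline xm u (fst x) = snd x"
    using IVT'[of "\<lambda>u. tline xm u (fst x)" "fst x" "snd x" "fst x - xm"] x xm xi_bounds
      continuous_on_tline[of xm _ "fst x"]
    by (auto simp: tline_0 tline_tangent_eq)
  have eq: "tline xm u (fst x) = exp u * ((fst x - u) / (1 - xm) + 1)" for u
    by (simp add: tline_def)
  show "fst x \<le> um C x" "um C x \<le> fst x - xm" "snd x = tline xm (um C x) (fst x)"
    unfolding um_def
    using theI[of "\<lambda>u. fst x \<le> u \<and> u \<le> fst x - xm \<and> snd x = tline xm u (fst x)" u]
      u tline_less(2)[OF xi_bounds(4), of _ _ "fst x"] unfolding eq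
    by (smt (verit))+
qed

lemma up_ge:
  assumes "x \<in> \<Omega> C" "snd x \<le> tline xp w (fst x) \<or> w \<le> fst x - xp"
  shows "w \<le> up C x"
  using assms up[OF assms(1)] tline_less(1)[OF xp(2), of "up C x" w "fst x"] by fastforce

lemma up_le:
  assumes "x \<in> \<Omega> C" "tline xp w (fst x) \<le> snd x" "fst x - xp \<le> w"
  shows "up C x \<le> w"
  using assms up[OF assms(1)] tline_less(1)[OF xp(2), of w "up C x" "fst x"] by fastforce

lemma um_le:
  assumes "x \<in> \<Omega> C" "snd x \<le> tline xm w (fst x) \<or> fst x - xm \<le> w"
  shows "um C x \<le> w"
  using assms um[OF assms(1)] tline_less(2)[OF xi_bounds(4), of w "um C x" "fst x"] by fastforce

end

subsection \<open>Criteria for the characteristic\<close>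

lemma is_interval_subset_Q:
  assumes J: "is_interval J" "J \<subseteq> Q" "0 < measure lebesgue J"
  obtains a b where "0 \<le> a" "a < b" "b \<le> 1"
    "negligible ({a<..<b} - J)" "negligible (J - {a<..<b})"
proof -
  have bdd: "bdd_below J" "bdd_above J"
    using J(2) by (auto intro: bdd_below_mono bdd_above_mono)
  have ne: "J \<noteq> {}" using J(3) by auto
  define a b where "a = Inf J" and "b = Sup J"
  have sub: "J \<subseteq> {a..b}"
    using bdd by (auto simp: a_def b_def intro: cInf_lower cSup_upper)
  have "{a<..<b} \<subseteq> J"
  proof
    fix t assume t: "t \<in> {a<..<b}"
    obtain r where "r \<in> J" "r < t"
      using t cInf_less_iff[OF ne bdd(1)] by (auto simp: a_def)
    moreover obtain s where "s \<in> J" "t < s"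
      using t less_cSup_iff[OF ne bdd(2)] by (auto simp: b_def)
    ultimately show "t \<in> J"
      using J(1) unfolding is_interval_1 by (meson less_imp_le)
  qed
  then have diff: "{a<..<b} - J = {}" "J - {a<..<b} \<subseteq> {a, b}"
    using sub by auto
  have "a < b"
  proof (rule ccontr)
    assume "\<not> a < b"
    then have "J \<subseteq> {a}" using sub by auto
    then have "negligible J" by (rule negligible_subset[rotated]) simp
    then show False
      using J(3) by (simp add: negligible_iff_measure)
  qed
  moreover have "0 \<le> a" "b \<le> 1"
    using J(2) ne by (auto simp: a_def b_def intro!: cInf_greatest cSup_least)
  ultimately show thesis
    using that diff negligible_subset[of "{a, b}"] by (metis finite.emptyI finite_insert negligible_finite)
qed

lemma avg_spike_set:
  assumes f: "has_abs_integral f I {a<..<b}" and "a < b"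
    and neg: "negligible ({a<..<b} - J)" "negligible (J - {a<..<b})"
  shows "avg J f = I / (b - a)"
proof -
  have "has_abs_integral f I J"
    using has_abs_integral_spike_set[OF f neg] .
  then have "(LINT t:J|lebesgue. f t) = I"
    using set_lebesgue_integral_eq_integral(2) has_abs_integralD by metis
  moreover have "has_abs_integral (\<lambda>_. 1) (b - a) J"
    using has_abs_integral_spike_set[OF has_abs_integral_const neg, of 1] \<open>a < b\<close> by simp
  then have "measure lebesgue J = b - a"
    using lmeasurable_iff_integrable_on lmeasure_integral has_abs_integralD(2,3) integrable_on_def by metis
  ultimately show ?thesis by (simp add: avg_def)
qed

lemma in_EI:
  assumes \<phi>: "has_abs_integral \<phi> (fst x) Q" and e: "has_abs_integral (\<lambda>t. exp (\<phi> t)) (snd x) Q"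
    and bound: "\<And>a b I W. 0 \<le> a \<Longrightarrow> a < b \<Longrightarrow> b \<le> 1 \<Longrightarrow> has_abs_integral \<phi> I {a<..<b} \<Longrightarrow>
       has_abs_integral (\<lambda>t. exp (\<phi> t)) W {a<..<b} \<Longrightarrow> W / (b - a) \<le> C * exp (I / (b - a))"
  shows "\<phi> \<in> E C x"
proof -
  have "avg J (\<lambda>t. exp (\<phi> t)) * exp (- avg J (\<lambda>t. ln (exp (\<phi> t)))) \<le> C"
    if J: "is_interval J" "J \<subseteq> Q" "0 < measure lebesgue J" for J
  proof -
    obtain a b where ab: "0 \<le> a" "a < b" "b \<le> 1"
      and neg: "negligible ({a<..<b} - J)" "negligible (J - {a<..<b})"
      using is_interval_subset_Q[OF J] .
    have sub: "{a<..<b} \<subseteq> Q" using ab by auto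
    obtain I W where IW: "has_abs_integral \<phi> I {a<..<b}"
        "has_abs_integral (\<lambda>t. exp (\<phi> t)) W {a<..<b}"
      using has_abs_integral_exists[OF set_integrable_subset[OF has_abs_integralD(1)[OF \<phi>] _ sub]]
        has_abs_integral_exists[OF set_integrable_subset[OF has_abs_integralD(1)[OF e] _ sub]] by auto
    have "W / (b - a) * exp (- (I / (b - a))) \<le> C * exp (I / (b - a)) * exp (- (I / (b - a)))"
      using bound[OF ab IW] by (intro mult_right_mono) auto
    also have "\<dots> = C"
      by (simp flip: exp_add)
    finally show ?thesis
      using avg_spike_set[OF IW(1) ab(2) neg] avg_spike_set[OF IW(2) ab(2) neg] by simp
  qed
  then show ?thesis
    using has_abs_integralD(1)[OF \<phi>] has_abs_integralD(1)[OF e]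
      avg_interval[OF \<phi>] avg_interval[OF e]
    by (auto simp: E_def A_infty_char_def intro!: SUP_least)
qed

lemma optimizerI:
  assumes "\<phi> \<in> E C x" "has_abs_integral (\<lambda>t. f (\<phi> t)) (G x) Q"
  shows "optimizer C f G x \<phi>"
  using assms has_abs_integralD(1)[OF assms(2)] avg_interval[OF assms(2)]
  by (simp add: optimizer_def)

lemma has_abs_integral_tline:
  assumes "has_abs_integral g I {a<..<b}" "a < b"
  shows "has_abs_integral (\<lambda>t. tline \<xi> u (g t)) ((b - a) * tline \<xi> u (I / (b - a))) {a<..<b}"
proof -
  define k where "k = exp u / (1 - \<xi>)"
  have eq: "tline \<xi> u y = (exp u - k * u) + k * y" for y
    by (simp add: tline_def k_def algebra_simps diff_divide_distrib add_divide_distrib)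
  show ?thesis
    unfolding eq using assms
    by (intro has_abs_integral_cong[OF has_abs_integral_affine[OF assms(1), of "exp u - k * u" k]])
       (auto simp: field_simps)
qed

context A_infty_bound
begin

lemma tangent_criterion:
  assumes "a < b" "W \<le> (b - a) * tline xp u (I / (b - a))"
  shows "W / (b - a) \<le> C * exp (I / (b - a))"
proof -
  have "W / (b - a) \<le> tline xp u (I / (b - a))"
    using assms by (simp add: field_simps)
  also have "\<dots> \<le> C * exp (I / (b - a))"
    by (rule tline_le)
  finally show ?thesis .
qed

lemma oscillation_criterion:
  assumes g: "has_abs_integral g I {a<..<b}" "has_abs_integral (\<lambda>t. exp (g t)) W {a<..<b}"
    and "a < b" and osc: "\<And>t. t \<in> {a<..<b} \<Longrightarrow> u \<le> g t \<and> g t \<le> u + d"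
  shows "W / (b - a) \<le> C * exp (I / (b - a))"
proof (rule tangent_criterion[OF \<open>a < b\<close>])
  show "W \<le> (b - a) * tline xp u (I / (b - a))"
    by (rule has_abs_integral_mono[OF g(2) has_abs_integral_tline[OF g(1) \<open>a < b\<close>]])
       (use osc exp_le_tline in auto)
qed

lemma initial_segments_criterion:
  assumes g: "has_abs_integral g (fst x) Q" and e: "has_abs_integral (\<lambda>t. exp (g t)) (snd x) Q"
    and seg: "\<And>b. 0 < b \<Longrightarrow> b \<le> 1 \<Longrightarrow> \<exists>u I W.
       has_abs_integral g I {0<..<b} \<and> has_abs_integral (\<lambda>t. exp (g t)) W {0<..<b} \<and>
       W \<le> b * tline xp u (I / b) \<and>
       (\<forall>a. 0 < a \<and> a < b \<longrightarrow> (\<forall>t\<in>{a<..<b}. u \<le> g t \<and> g t \<le> u + d) \<or>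
                            (\<forall>t\<in>{0<..<a}. g t \<le> u \<or> u + d \<le> g t))"
  shows "g \<in> E C x"
proof (rule in_EI[OF g e])
  fix a b I W
  assume ab: "0 \<le> a" "a < b" "b \<le> 1"
    and I: "has_abs_integral g I {a<..<b}" and W: "has_abs_integral (\<lambda>t. exp (g t)) W {a<..<b}"
  obtain u I0 W0 where u: "has_abs_integral g I0 {0<..<b}" "has_abs_integral (\<lambda>t. exp (g t)) W0 {0<..<b}"
       "W0 \<le> b * tline xp u (I0 / b)"
       "0 < a \<Longrightarrow> (\<forall>t\<in>{a<..<b}. u \<le> g t \<and> g t \<le> u + d) \<or>
                 (\<forall>t\<in>{0<..<a}. g t \<le> u \<or> u + d \<le> g t)"
    using seg[of b] ab by auto
  show "W / (b - a) \<le> C * exp (I / (b - a))"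
  proof (cases "a = 0")
    case True
    then show ?thesis
      using u(3) tangent_criterion[of 0 b W0 u I0] ab has_abs_integral_unique[OF u(1)]
        has_abs_integral_unique[OF u(2)] I W by auto
  next
    case False
    then have a: "0 < a" using ab by simp
    show ?thesis
    proof (cases "\<forall>t\<in>{a<..<b}. u \<le> g t \<and> g t \<le> u + d")
      case True
      then show ?thesis
        using oscillation_criterion[OF I W ab(2)] by blast
    next
      case False
      with u(4)[OF a] have out: "\<And>t. t \<in> {0<..<a} \<Longrightarrow> tline xp u (g t) \<le> exp (g t)"
        using tline_le_exp by blast
      obtain I1 I2 where I12: "has_abs_integral g I1 {0<..<a}" "has_abs_integral g I2 {a<..<b}"
        "I0 = I1 + I2"
        using has_abs_integral_split[OF u(1), of a] a ab by auto
      obtain W1 W2 where W12: "has_abs_integral (\<lambda>t. exp (g t)) W1 {0<..<a}"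
        "has_abs_integral (\<lambda>t. exp (g t)) W2 {a<..<b}" "W0 = W1 + W2"
        using has_abs_integral_split[OF u(2), of a] a ab by auto
      have eq: "I2 = I" "W2 = W"
        using I12 W12 I W has_abs_integral_unique by blast+
      have t1: "has_abs_integral (\<lambda>t. tline xp u (g t)) ((a - 0) * tline xp u (I1 / (a - 0))) {0<..<a}"
        by (rule has_abs_integral_tline[OF I12(1) a])
      have t2: "has_abs_integral (\<lambda>t. tline xp u (g t)) ((b - a) * tline xp u (I / (b - a))) {a<..<b}"
        by (rule has_abs_integral_tline[OF I ab(2)])
      have t3: "has_abs_integral (\<lambda>t. tline xp u (g t)) ((b - 0) * tline xp u (I0 / (b - 0))) {0<..<b}"
        by (rule has_abs_integral_tline[OF u(1)]) (use a ab in auto)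
      have "b * tline xp u (I0 / b) = a * tline xp u (I1 / a) + (b - a) * tline xp u (I / (b - a))"
        using has_abs_integral_unique[OF t3 has_abs_integral_combine[OF t1 t2]] a ab by simp
      moreover have "a * tline xp u (I1 / a) \<le> W1"
        using has_abs_integral_mono[OF t1 W12(1) out] by simp
      ultimately have "W \<le> (b - a) * tline xp u (I / (b - a))"
        using u(3) W12(3) eq by simp
      then show ?thesis
        by (rule tangent_criterion[OF ab(2)])
    qed
  qed
qed

lemma E_antimono:
  assumes g: "has_abs_integral g (fst x) Q" and e: "has_abs_integral (\<lambda>t. exp (g t)) (snd x) Q"
    and mono: "\<And>s t. 0 < s \<Longrightarrow> s \<le> t \<Longrightarrow> t \<le> 1 \<Longrightarrow> g t \<le> g s"
    and seg: "\<And>b. 0 < b \<Longrightarrow> b \<le> 1 \<Longrightarrow> \<exists>I W.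
       has_abs_integral g I {0<..<b} \<and> has_abs_integral (\<lambda>t. exp (g t)) W {0<..<b} \<and>
       W \<le> b * tline xp (g b) (I / b)"
  shows "g \<in> E C x"
proof (rule initial_segments_criterion[OF g e])
  fix b :: real assume b: "0 < b" "b \<le> 1"
  have "(\<forall>t\<in>{a<..<b}. g b \<le> g t \<and> g t \<le> g b + d) \<or> (\<forall>t\<in>{0<..<a}. g t \<le> g b \<or> g b + d \<le> g t)"
    if "0 < a" "a < b" for a
  proof (cases "g a \<le> g b + d")
    case True
    have "g b \<le> g t \<and> g t \<le> g b + d" if "t \<in> {a<..<b}" for t
      using mono[of t b] mono[of a t] that True \<open>0 < a\<close> b by auto
    then show ?thesis by blast
  next
    case False
    have "g b + d \<le> g t" if "t \<in> {0<..<a}" for t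
      using mono[of t a] that False \<open>a < b\<close> b by auto
    then show ?thesis by blast
  qed
  then show "\<exists>u I W.
       has_abs_integral g I {0<..<b} \<and> has_abs_integral (\<lambda>t. exp (g t)) W {0<..<b} \<and>
       W \<le> b * tline xp u (I / b) \<and>
       (\<forall>a. 0 < a \<and> a < b \<longrightarrow> (\<forall>t\<in>{a<..<b}. u \<le> g t \<and> g t \<le> u + d) \<or>
                            (\<forall>t\<in>{0<..<a}. g t \<le> u \<or> u + d \<le> g t))"
    using seg[OF b] by blast
qed

lemma E_mono:
  assumes g: "has_abs_integral g (fst x) Q" and e: "has_abs_integral (\<lambda>t. exp (g t)) (snd x) Q"
    and mono: "\<And>s t. 0 < s \<Longrightarrow> s \<le> t \<Longrightarrow> t \<le> 1 \<Longrightarrow> g s \<le> g t"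
    and seg: "\<And>b. 0 < b \<Longrightarrow> b \<le> 1 \<Longrightarrow> \<exists>I W.
       has_abs_integral g I {0<..<b} \<and> has_abs_integral (\<lambda>t. exp (g t)) W {0<..<b} \<and>
       W \<le> b * tline xm (g b) (I / b)"
  shows "g \<in> E C x"
proof (rule initial_segments_criterion[OF g e])
  fix b :: real assume b: "0 < b" "b \<le> 1"
  have "(\<forall>t\<in>{a<..<b}. g b - d \<le> g t \<and> g t \<le> g b - d + d) \<or>
        (\<forall>t\<in>{0<..<a}. g t \<le> g b - d \<or> g b - d + d \<le> g t)"
    if "0 < a" "a < b" for a
  proof (cases "g b - d \<le> g a")
    case True
    have "g b - d \<le> g t \<and> g t \<le> g b - d + d" if "t \<in> {a<..<b}" for t
      using mono[of t b] mono[of a t] that True \<open>0 < a\<close> b by auto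
    then show ?thesis by blast
  next
    case False
    have "g t \<le> g b - d" if "t \<in> {0<..<a}" for t
      using mono[of t a] that False \<open>a < b\<close> b by auto
    then show ?thesis by blast
  qed
  then show "\<exists>u I W.
       has_abs_integral g I {0<..<b} \<and> has_abs_integral (\<lambda>t. exp (g t)) W {0<..<b} \<and>
       W \<le> b * tline xp u (I / b) \<and>
       (\<forall>a. 0 < a \<and> a < b \<longrightarrow> (\<forall>t\<in>{a<..<b}. u \<le> g t \<and> g t \<le> u + d) \<or>
                            (\<forall>t\<in>{0<..<a}. g t \<le> u \<or> u + d \<le> g t))"
    using seg[OF b] unfolding tline_xm by blast
qed

end

lemma E_transfer:
  assumes g: "g \<in> E C y" and N: "negligible N" "\<And>t. t \<in> Q - N \<Longrightarrow> \<phi> t = c + g t"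
    and x: "fst x = c + fst y" "snd x = exp c * snd y"
  shows "\<phi> \<in> E C x"
proof -
  have gI: "g absolutely_integrable_on Q" "(\<lambda>t. exp (g t)) absolutely_integrable_on Q"
    and gavg: "avg Q g = fst y" "avg Q (\<lambda>t. exp (g t)) = snd y"
    and gA: "A_infty_char (\<lambda>t. exp (g t)) \<le> ereal C"
    using g by (auto simp: E_def)
  have *: "\<phi> absolutely_integrable_on J \<and> (\<lambda>t. exp (\<phi> t)) absolutely_integrable_on J \<and>
      avg J \<phi> = c + avg J g \<and> avg J (\<lambda>t. exp (\<phi> t)) = exp c * avg J (\<lambda>t. exp (g t))"
    if "J \<subseteq> Q" "0 < measure lebesgue J" for J
  proof -
    have J: "J \<in> sets lebesgue"
      using that(2) measure_notin_sets by fastforce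
    then have Jl: "J \<in> lmeasurable"
      using that(1) by (intro bounded_set_imp_lmeasurable bounded_subset[OF compact_imp_bounded[OF compact_Icc[of 0 1]]]) auto
    have sub: "g absolutely_integrable_on J" "(\<lambda>t. exp (g t)) absolutely_integrable_on J"
      using gI J that(1) set_integrable_subset by blast+
    have one: "has_abs_integral (\<lambda>_. 1) (measure lebesgue J) J"
      using Jl by (simp add: has_abs_integral_iff absolutely_integrable_on_const lmeasure_integral)
    have "has_abs_integral \<phi> (c * measure lebesgue J + integral J g) J"
      by (rule has_abs_integral_spike[OF has_abs_integral_add[OF has_abs_integral_cmul[OF one, of c]
            has_abs_integral_exists[OF sub(1)]] N(1)])
         (use N(2) that(1) in auto)
    moreover have "has_abs_integral (\<lambda>t. exp (\<phi> t)) (exp c * integral J (\<lambda>t. exp (g t))) J"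
      by (rule has_abs_integral_spike[OF has_abs_integral_cmul[OF has_abs_integral_exists[OF sub(2)], of "exp c"] N(1)])
         (use N(2) that(1) in \<open>auto simp flip: exp_add\<close>)
    ultimately show ?thesis
      using that(2) set_lebesgue_integral_eq_integral(2)[OF sub(1)]
        set_lebesgue_integral_eq_integral(2)[OF sub(2)]
        set_lebesgue_integral_eq_integral(2)[of J \<phi>]
        set_lebesgue_integral_eq_integral(2)[of J "\<lambda>t. exp (\<phi> t)"]
      by (simp add: has_abs_integral_iff avg_def field_simps)
  qed
  have "A_infty_char (\<lambda>t. exp (\<phi> t)) \<le> A_infty_char (\<lambda>t. exp (g t))"
    unfolding A_infty_char_def
  proof (rule SUP_mono)
    fix J assume J: "J \<in> {J. is_interval J \<and> J \<subseteq> Q \<and> 0 < measure lebesgue J}"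
    then have "avg J (\<lambda>t. exp (\<phi> t)) * exp (- avg J (\<lambda>t. ln (exp (\<phi> t)))) =
               avg J (\<lambda>t. exp (g t)) * exp (- avg J (\<lambda>t. ln (exp (g t))))"
      using *[of J] by (simp flip: exp_add)
    then show "\<exists>K\<in>{J. is_interval J \<and> J \<subseteq> Q \<and> 0 < measure lebesgue J}.
       ereal (avg J (\<lambda>t. exp (\<phi> t)) * exp (- avg J (\<lambda>t. ln (exp (\<phi> t)))))
       \<le> ereal (avg K (\<lambda>t. exp (g t)) * exp (- avg K (\<lambda>t. ln (exp (g t)))))"
      using J by (intro bexI[of _ J]) auto
  qed
  then show ?thesis
    using gA gavg *[of Q] x by (auto simp: E_def)
qed

subsection \<open>Logarithmic optimizers\<close>

lemma has_abs_integral_log_moments: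
  shows "has_abs_integral (\<lambda>s. (v + \<xi> * s) * exp (- s)) (v + \<xi>) {0<..}"
    and "has_abs_integral (\<lambda>s. (v + \<xi> * s)\<^sup>2 * exp (- s)) (v\<^sup>2 + 2 * v * \<xi> + 2 * \<xi>\<^sup>2) {0<..}"
    and "k * \<xi> < 1 \<Longrightarrow>
      has_abs_integral (\<lambda>s. exp (k * (v + \<xi> * s)) * exp (- s)) (exp (k * v) / (1 - k * \<xi>)) {0<..}"
proof -
  note p = has_abs_integral_power[of 0] has_abs_integral_power[of 1] has_abs_integral_power[of 2]
  show "has_abs_integral (\<lambda>s. (v + \<xi> * s) * exp (- s)) (v + \<xi>) {0<..}"
    by (rule has_abs_integral_cong[OF has_abs_integral_add[OF
          has_abs_integral_cmul[OF p(1), of v] has_abs_integral_cmul[OF p(2), of \<xi>]]])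
       (auto simp: algebra_simps)
  show "has_abs_integral (\<lambda>s. (v + \<xi> * s)\<^sup>2 * exp (- s)) (v\<^sup>2 + 2 * v * \<xi> + 2 * \<xi>\<^sup>2) {0<..}"
    by (rule has_abs_integral_cong[OF has_abs_integral_add[OF has_abs_integral_add[OF
          has_abs_integral_cmul[OF p(1), of "v\<^sup>2"] has_abs_integral_cmul[OF p(2), of "2 * v * \<xi>"]]
          has_abs_integral_cmul[OF p(3), of "\<xi>\<^sup>2"]]])
       (auto simp: algebra_simps power2_eq_square)
  show "has_abs_integral (\<lambda>s. exp (k * (v + \<xi> * s)) * exp (- s)) (exp (k * v) / (1 - k * \<xi>)) {0<..}"
    if "k * \<xi> < 1"
    by (rule has_abs_integral_cong[OF has_abs_integral_cmul[OF has_abs_integral_exp[OF that], of "exp (k * v)"]])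
       (auto simp: algebra_simps simp flip: exp_add)
qed

lemma tlog_rescale:
  assumes "0 \<le> \<alpha>" "0 < t" "t \<le> b"
  shows "tlog \<alpha> t = tlog \<alpha> b + tlog (min \<alpha> b) t"
proof (cases "b \<le> \<alpha>")
  case True
  then show ?thesis
    using assms by (simp add: tlog_simps ln_div)
next
  case False
  then show ?thesis
    using assms by (simp add: tlog_simps)
qed

lemma tlog_antimono:
  assumes "0 \<le> \<alpha>" "0 < s" "s \<le> t"
  shows "tlog \<alpha> t \<le> tlog \<alpha> s"
  using tlog_rescale[OF assms] by (simp add: tlog_def)

lemma has_abs_integral_log:
  assumes "0 \<le> \<alpha>" "\<alpha> \<le> b"
  shows "has_abs_integral (\<lambda>t. v + \<xi> * tlog \<alpha> t) (b * v + \<alpha> * \<xi>) {0<..<b}"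
    and "\<xi> < 1 \<Longrightarrow> has_abs_integral (\<lambda>t. exp (v + \<xi> * tlog \<alpha> t))
      (exp v * (b + \<alpha> * \<xi> / (1 - \<xi>))) {0<..<b}"
proof -
  show "has_abs_integral (\<lambda>t. v + \<xi> * tlog \<alpha> t) (b * v + \<alpha> * \<xi>) {0<..<b}"
    by (rule has_abs_integral_cong[OF has_abs_integral_tlog[OF has_abs_integral_log_moments(1) assms]])
       (auto simp: algebra_simps)
  have "exp v * (b + \<alpha> * \<xi> / (1 - \<xi>)) = \<alpha> * (exp (1 * v) / (1 - 1 * \<xi>)) + (b - \<alpha>) * exp (1 * (v + \<xi> * 0))"
    if "\<xi> < 1"
    using that by (simp add: field_simps)
  then show "has_abs_integral (\<lambda>t. exp (v + \<xi> * tlog \<alpha> t))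
      (exp v * (b + \<alpha> * \<xi> / (1 - \<xi>))) {0<..<b}" if "\<xi> < 1"
    using that
    by (intro has_abs_integral_cong[OF has_abs_integral_tlog[OF has_abs_integral_log_moments(3) assms], of 1]) auto
qed

lemma log_initial_segment:
  assumes "\<xi> < 1" "0 \<le> \<alpha>" "0 < b"
    and g: "\<And>t. 0 < t \<Longrightarrow> g t = u + \<xi> * tlog \<alpha> t"
  obtains I where "has_abs_integral g I {0<..<b}"
    "has_abs_integral (\<lambda>t. exp (g t)) (b * tline \<xi> (g b) (I / b)) {0<..<b}"
proof -
  define a where "a = min \<alpha> b"
  have a: "0 \<le> a" "a \<le> b" using assms by (auto simp: a_def)
  have gt: "g t = g b + \<xi> * tlog a t" if "t \<in> {0<..<b}" for t
    using g[of b] g[of t] tlog_rescale[OF assms(2), of t b] that \<open>0 < b\<close>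
    by (simp add: a_def algebra_simps)
  have 1: "has_abs_integral g (b * g b + a * \<xi>) {0<..<b}"
    by (rule has_abs_integral_cong[OF has_abs_integral_log(1)[OF a]]) (auto simp: gt)
  have "b * tline \<xi> (g b) ((b * g b + a * \<xi>) / b) = exp (g b) * (b + a * \<xi> / (1 - \<xi>))"
  proof -
    have "(b * g b + a * \<xi>) / b - g b = a * \<xi> / b"
      and "b * (1 + a * \<xi> / b / (1 - \<xi>)) = b + a * \<xi> / (1 - \<xi>)"
      using \<open>0 < b\<close> by (simp_all add: diff_divide_distrib add_divide_distrib distrib_left)
    then show ?thesis by (simp add: tline_def)
  qed
  then have 2: "has_abs_integral (\<lambda>t. exp (g t)) (b * tline \<xi> (g b) ((b * g b + a * \<xi>) / b)) {0<..<b}"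
    using has_abs_integral_cong[OF has_abs_integral_log(2)[OF a \<open>\<xi> < 1\<close>, of "g b"]]
    by (simp add: gt)
  show thesis using that[OF 1 2] .
qed

context A_infty_bound
begin

lemma \<alpha>p_bounds:
  assumes "x \<in> \<Omega> C"
  shows "0 \<le> (fst x - up C x) / xp" "(fst x - up C x) / xp \<le> 1"
  using up[OF assms] xp by auto

lemma \<alpha>m_bounds:
  assumes "x \<in> \<Omega> C"
  shows "0 \<le> (fst x - um C x) / xm" "(fst x - um C x) / xm \<le> 1"
  using um[OF assms] xm by (auto simp: divide_simps)

lemma \<phi>p_eq:
  assumes "x \<in> \<Omega> C" "0 < t"
  shows "\<phi>p C x t = up C x + xp * tlog ((fst x - up C x) / xp) t"
  using \<alpha>p_bounds(1)[OF assms(1)] assms(2)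
  by (cases "t < (fst x - up C x) / xp") (simp_all add: \<phi>p_def tlog_simps)

lemma \<phi>m_eq:
  assumes "x \<in> \<Omega> C" "0 < t"
  shows "\<phi>m C x t = um C x + xm * tlog ((fst x - um C x) / xm) t"
  using \<alpha>m_bounds(1)[OF assms(1)] assms(2)
  by (cases "t < (fst x - um C x) / xm") (simp_all add: \<phi>m_def tlog_simps)

lemma has_abs_integral_\<phi>p:
  assumes "x \<in> \<Omega> C" "has_abs_integral (\<lambda>s. F (up C x + xp * s) * exp (- s)) I {0<..}"
    and "J = (fst x - up C x) / xp * I + (1 - (fst x - up C x) / xp) * F (up C x)"
  shows "has_abs_integral (\<lambda>t. F (\<phi>p C x t)) J Q"
  by (rule has_abs_integral_cong[OF has_abs_integral_tlog[where F = "\<lambda>s. F (up C x + xp * s)",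
        OF assms(2) \<alpha>p_bounds[OF assms(1)]]]) (use assms in \<open>auto simp: \<phi>p_eq\<close>)

lemma has_abs_integral_\<phi>m:
  assumes "x \<in> \<Omega> C" "has_abs_integral (\<lambda>s. F (um C x + xm * s) * exp (- s)) I {0<..}"
    and "J = (fst x - um C x) / xm * I + (1 - (fst x - um C x) / xm) * F (um C x)"
  shows "has_abs_integral (\<lambda>t. F (\<phi>m C x t)) J Q"
  by (rule has_abs_integral_cong[OF has_abs_integral_tlog[where F = "\<lambda>s. F (um C x + xm * s)",
        OF assms(2) \<alpha>m_bounds[OF assms(1)]]]) (use assms in \<open>auto simp: \<phi>m_eq\<close>)

lemma exp_\<phi>p:
  assumes "x \<in> \<Omega> C" "k * xp < 1"
  shows "has_abs_integral (\<lambda>t. exp (k * \<phi>p C x t))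
    (exp (k * up C x) * (k / (1 - k * xp) * (fst x - up C x) + 1)) Q"
  by (rule has_abs_integral_\<phi>p[where F = "\<lambda>y. exp (k * y)",
        OF assms(1) has_abs_integral_log_moments(3)[OF assms(2)]])
     (use xp assms(2) in \<open>simp add: divide_simps, simp add: algebra_simps\<close>)

lemma exp_\<phi>m:
  assumes "x \<in> \<Omega> C" "k * xm < 1"
  shows "has_abs_integral (\<lambda>t. exp (k * \<phi>m C x t))
    (exp (k * um C x) * (k / (1 - k * xm) * (fst x - um C x) + 1)) Q"
  by (rule has_abs_integral_\<phi>m[where F = "\<lambda>y. exp (k * y)",
        OF assms(1) has_abs_integral_log_moments(3)[OF assms(2)]])
     (use xm assms(2) in \<open>simp add: divide_simps, simp add: algebra_simps\<close>)

lemma \<phi>p_moments: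
  assumes x: "x \<in> \<Omega> C"
  shows "has_abs_integral (\<phi>p C x) (fst x) Q" "has_abs_integral (\<lambda>t. exp (\<phi>p C x t)) (snd x) Q"
proof -
  show "has_abs_integral (\<phi>p C x) (fst x) Q"
    by (rule has_abs_integral_\<phi>p[where F = "\<lambda>y. y", OF x has_abs_integral_log_moments(1)])
       (use xp in \<open>simp add: field_simps\<close>)
  show "has_abs_integral (\<lambda>t. exp (\<phi>p C x t)) (snd x) Q"
    by (rule has_abs_integral_cong[OF exp_\<phi>p[of x 1]]) (use x up[OF x] xp in \<open>auto simp: tline_def add.commute\<close>)
qed

lemma \<phi>p_in_E:
  assumes x: "x \<in> \<Omega> C"
  shows "\<phi>p C x \<in> E C x"
proof (rule E_antimono[OF \<phi>p_moments[OF x]])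
  show "\<phi>p C x t \<le> \<phi>p C x s" if "0 < s" "s \<le> t" for s t
    using that xp tlog_antimono[OF \<alpha>p_bounds(1)[OF x] that] by (simp add: \<phi>p_eq[OF x])
  show "\<exists>I W. has_abs_integral (\<phi>p C x) I {0<..<b} \<and> has_abs_integral (\<lambda>t. exp (\<phi>p C x t)) W {0<..<b} \<and>
       W \<le> b * tline xp (\<phi>p C x b) (I / b)" if "0 < b" for b
    using log_initial_segment[OF xp(2) \<alpha>p_bounds(1)[OF x] that \<phi>p_eq[OF x]] order_refl by metis
qed

lemma \<phi>m_in_E:
  assumes x: "x \<in> \<Omega> C"
  shows "\<phi>m C x \<in> E C x"
proof (rule E_mono)
  show "has_abs_integral (\<phi>m C x) (fst x) Q"
    by (rule has_abs_integral_\<phi>m[where F = "\<lambda>y. y", OF x has_abs_integral_log_moments(1)])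
       (use xm in \<open>simp add: field_simps\<close>)
  show "has_abs_integral (\<lambda>t. exp (\<phi>m C x t)) (snd x) Q"
    by (rule has_abs_integral_cong[OF exp_\<phi>m[of x 1]]) (use x um[OF x] xm in \<open>auto simp: tline_def add.commute\<close>)
  show "\<phi>m C x s \<le> \<phi>m C x t" if "0 < s" "s \<le> t" for s t
    using that xm tlog_antimono[OF \<alpha>m_bounds(1)[OF x] that] by (simp add: \<phi>m_eq[OF x])
  show "\<exists>I W. has_abs_integral (\<phi>m C x) I {0<..<b} \<and> has_abs_integral (\<lambda>t. exp (\<phi>m C x t)) W {0<..<b} \<and>
       W \<le> b * tline xm (\<phi>m C x b) (I / b)" if "0 < b" for b
    using log_initial_segment[OF xi_bounds(4) \<alpha>m_bounds(1)[OF x] that \<phi>m_eq[OF x]] order_refl by metis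
qed

lemma \<phi>p_optimizer_b:
  assumes x: "x \<in> \<Omega> C" and p: "1 < p" "p \<le> 2"
  shows "optimizer C (\<lambda>t. \<bar>t\<bar> powr p) (b_cand p C) x (\<phi>p C x)"
proof (rule optimizerI[OF \<phi>p_in_E[OF x]])
  define u where "u = up C x"
  obtain K where K: "has_abs_integral (\<lambda>s. \<bar>u + xp * s\<bar> powr p * exp (- s)) (\<bar>u\<bar> powr p + p * xp * K) {0<..}"
    "has_abs_integral (\<lambda>s. (\<bar>u + xp * s\<bar> powr (p - 1) * sgn (u + xp * s)) * exp (- s)) K {0<..}"
    using has_abs_integral_abs_powr[OF p xp(1), of u] by blast
  have "has_abs_integral (\<lambda>r. (\<bar>r\<bar> powr (p - 1) * sgn r) * exp (- r / xp)) (xp * exp (- u / xp) * K) {u<..}"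
    by (rule has_abs_integral_affine_exp_substitution[OF K(2) xp(1)])
  note has_abs_integralD[OF this]
  then have L: "(LINT s:{u<..}|lebesgue. \<bar>s\<bar> powr (p - 1) * sgn s * exp (- s / xp)) = xp * exp (- u / xp) * K"
    by (simp only: set_lebesgue_integral_eq_integral(2))
  have "b_cand p C x = p * (exp (u / xp) * exp (- u / xp)) * K * (fst x - u) + \<bar>u\<bar> powr p"
    unfolding b_cand_def u_def[symmetric] L using xp by simp
  also have "exp (u / xp) * exp (- u / xp) = 1"
    by (simp flip: exp_add)
  finally have b: "b_cand p C x = p * K * (fst x - u) + \<bar>u\<bar> powr p" by simp
  show "has_abs_integral (\<lambda>t. \<bar>\<phi>p C x t\<bar> powr p) (b_cand p C x) Q"
    by (rule has_abs_integral_\<phi>p[where F = "\<lambda>y. \<bar>y\<bar> powr p", OF x K(1)[unfolded u_def]])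
       (use xp in \<open>simp add: b u_def field_simps\<close>)
qed

lemma \<phi>p_optimizer_A:
  assumes x: "x \<in> \<Omega> C" and "1 \<le> k" "k < 1 / xp"
  shows "optimizer C (\<lambda>t. exp (k * t)) (A_cand k C) x (\<phi>p C x)"
proof (rule optimizerI[OF \<phi>p_in_E[OF x]])
  have "k * xp < 1"
    using assms xp by (simp add: field_simps)
  then show "has_abs_integral (\<lambda>t. exp (k * \<phi>p C x t)) (A_cand k C x) Q"
    using exp_\<phi>p[OF x] by (simp add: A_cand_def)
qed

lemma \<phi>m_optimizer_B:
  assumes x: "x \<in> \<Omega> C"
  shows "optimizer C (\<lambda>t. t\<^sup>2) (B2_cand C) x (\<phi>m C x)"
proof (rule optimizerI[OF \<phi>m_in_E[OF x]])
  show "has_abs_integral (\<lambda>t. (\<phi>m C x t)\<^sup>2) (B2_cand C x) Q"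
    by (rule has_abs_integral_\<phi>m[where F = "\<lambda>y. y\<^sup>2", OF x has_abs_integral_log_moments(2)])
       (use xm in \<open>simp add: B2_cand_def power2_eq_square field_simps\<close>)
qed

end

subsection \<open>Step functions\<close>

lemma has_abs_integral_three_step:
  assumes "a \<le> r" "r \<le> s" "s \<le> b"
    and "\<And>t. a < t \<Longrightarrow> t < r \<Longrightarrow> f t = p"
    and "\<And>t. r < t \<Longrightarrow> t < s \<Longrightarrow> f t = q"
    and "\<And>t. s < t \<Longrightarrow> t < b \<Longrightarrow> f t = w"
  shows "has_abs_integral f ((r - a) * p + (s - r) * q + (b - s) * w) {a<..<b}"
proof -
  have "has_abs_integral f ((r - a) * p) {a<..<r}"
    by (rule has_abs_integral_cong[OF has_abs_integral_const[of a r p]]) (use assms in auto)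
  moreover have "has_abs_integral f ((s - r) * q) {r<..<s}"
    by (rule has_abs_integral_cong[OF has_abs_integral_const[of r s q]]) (use assms in auto)
  moreover have "has_abs_integral f ((b - s) * w) {s<..<b}"
    by (rule has_abs_integral_cong[OF has_abs_integral_const[of s b w]]) (use assms in auto)
  ultimately show ?thesis
    using assms(1-3) by (meson has_abs_integral_combine order_trans)
qed

lemma has_abs_integral_two_step:
  assumes "a \<le> r" "r \<le> b" "\<And>t. a < t \<Longrightarrow> t < r \<Longrightarrow> f t = p" "\<And>t. r < t \<Longrightarrow> t < b \<Longrightarrow> f t = q"
    and "I = (r - a) * p + (b - r) * q"
  shows "has_abs_integral f I {a<..<b}"
  by (rule has_abs_integral_cong[OF has_abs_integral_three_step[of a r r b f p 0 q]])
     (use assms in auto)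

context A_infty_bound
begin

lemma E_small_oscillation:
  assumes "has_abs_integral g (fst x) Q" "has_abs_integral (\<lambda>t. exp (g t)) (snd x) Q"
    and "\<And>t. u \<le> g t \<and> g t \<le> u + d"
  shows "g \<in> E C x"
  by (rule in_EI[OF assms(1,2)]) (use oscillation_criterion assms(3) in blast)

lemma exp_deviation:
  assumes "xp \<le> y \<or> y \<le> xm"
  shows "C * exp y * (1 - y) \<le> 1"
proof -
  have "tline 0 y 0 \<le> tline 0 xp 0" if "xp \<le> y"
    using that tline_less(1)[of 0 xp y 0] xp by fastforce
  moreover have "tline 0 y 0 \<le> tline 0 xm 0" if "y \<le> xm"
    using that tline_less(2)[of 0 y xm 0] xm by fastforce
  moreover have "tline 0 xp 0 = 1 / C" "tline 0 xm 0 = 1 / C"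
    using xi_equation_iff xp(3) xm(2) by blast+
  ultimately have "tline 0 y 0 \<le> 1 / C"
    using assms by auto
  then show ?thesis
    using C_gt_1 by (simp add: tline_def field_simps)
qed

lemma remove_constant_part:
  assumes X: "W / L \<le> C * exp (I / L)" and "0 \<le> k" "k < L"
    and far: "xp \<le> I / L - u \<or> I / L - u \<le> xm"
  shows "(W - k * exp u) / (L - k) \<le> C * exp ((I - k * u) / (L - k))"
proof -
  define X where "X = I / L"
  have L: "0 < L" "0 < L - k" using assms by auto
  define \<tau> where "\<tau> = k / (L - k)"
  have \<tau>: "0 \<le> \<tau>" "k = \<tau> * (L - k)"
    using assms by (auto simp: \<tau>_def)
  have I: "I = X * L" using L by (simp add: X_def)
  have eI: "(I - k * u) / (L - k) = X + \<tau> * (X - u)"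
  proof -
    have "(X + \<tau> * (X - u)) * (L - k) = X * (L - k) + (\<tau> * (L - k)) * (X - u)"
      by (simp add: algebra_simps)
    also have "\<dots> = I - k * u"
      unfolding \<tau>(2)[symmetric] I by (simp add: algebra_simps)
    finally have "I - k * u = (X + \<tau> * (X - u)) * (L - k)" by simp
    then show ?thesis using L by simp
  qed
  have eW: "(W - k * exp u) / (L - k) = (W / L) * (1 + \<tau>) - \<tau> * exp u"
  proof -
    have "W / (L - k) = W / L * (1 + \<tau>)"
      using L by (simp add: \<tau>_def field_simps)
    then show ?thesis
      by (simp add: diff_divide_distrib \<tau>_def)
  qed
  have "C * exp (X - u) * (1 - (X - u)) * exp u \<le> 1 * exp u"
    using exp_deviation[OF far] unfolding X_def by (intro mult_right_mono) auto
  also have "C * exp (X - u) * (1 - (X - u)) * exp u = C * exp X * (1 - (X - u))"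
    by (simp add: exp_diff)
  finally have dev: "C * exp X * (1 - (X - u)) \<le> exp u" by simp
  have "(W - k * exp u) / (L - k) \<le> C * exp X * (1 + \<tau>) - \<tau> * exp u"
    unfolding eW using X \<tau>(1) by (intro diff_right_mono mult_right_mono) (auto simp: X_def)
  also have "\<dots> \<le> C * exp X * (1 + \<tau>) - \<tau> * (C * exp X * (1 - (X - u)))"
    using dev \<tau>(1) by (intro diff_left_mono mult_left_mono) auto
  also have "\<dots> = C * (exp X * (1 + \<tau> * (X - u)))"
    by (simp add: algebra_simps)
  also have "\<dots> \<le> C * (exp X * exp (\<tau> * (X - u)))"
    using C_gt_1 by (intro mult_left_mono exp_ge_add_one_self) auto
  finally show ?thesis
    by (simp add: eI exp_add)
qed

lemma three_values_bound:
  assumes full: "c * exp d + (1 - c - e) + e * exp (- d) \<le> C * exp (d * (c - e))"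
    and ce: "0 \<le> P" "P \<le> c" "0 \<le> N" "N \<le> e" "c + e < 1 \<or> 0 < P \<or> 0 < N"
    and lo: "xm \<le> d * (c - e)" and hi: "d * c + xp * e \<le> xp"
    and sum: "c + e \<le> 1"
  shows "(P * exp d + (1 - c - e) + N * exp (- d)) / (P + (1 - c - e) + N)
    \<le> C * exp (d * (P - N) / (P + (1 - c - e) + N))"
proof -
  define M where "M = 1 - c - e"
  have pos: "0 < P + M + N" using ce sum by (auto simp: M_def)
  have "(c * exp d + M + e * exp (- d)) / 1 \<le> C * exp (d * (c - e) / 1)"
    using full by (simp add: M_def)
  moreover have "0 \<le> e - N" "e - N < 1" "xp \<le> d * (c - e) / 1 - (- d) \<or> d * (c - e) / 1 - (- d) \<le> xm"
    using ce lo pos by (auto simp: M_def)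
  ultimately have "(c * exp d + M + e * exp (- d) - (e - N) * exp (- d)) / (1 - (e - N))
      \<le> C * exp ((d * (c - e) - (e - N) * (- d)) / (1 - (e - N)))"
    by (rule remove_constant_part)
  moreover have "c * exp d + M + e * exp (- d) - (e - N) * exp (- d) = c * exp d + M + N * exp (- d)"
    "d * (c - e) - (e - N) * (- d) = d * (c - N)" "1 - (e - N) = c + M + N"
    by (simp_all add: algebra_simps M_def)
  ultimately have step: "(c * exp d + M + N * exp (- d)) / (c + M + N) \<le> C * exp (d * (c - N) / (c + M + N))"
    by (simp only:)
  have pos': "0 < c + M + N" using pos ce by simp
  have "d * (c - N) \<le> xp * (c + M + N)"
  proof -
    have "d * (c - N) \<le> d * c"
      using ce xi_bounds by (intro mult_left_mono) auto
    also have "\<dots> \<le> xp * (1 - e)"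
      using hi by (simp add: algebra_simps)
    also have "\<dots> \<le> xp * (c + M + N)"
      using ce xi_bounds by (intro mult_left_mono) (auto simp: M_def)
    finally show ?thesis .
  qed
  then have "d * (c - N) / (c + M + N) \<le> xp"
    using pos' by (simp add: field_simps)
  then have "d * (c - N) / (c + M + N) - d \<le> xm" by simp
  moreover have "0 \<le> c - P" "c - P < c + M + N" using ce pos by auto
  ultimately have "(c * exp d + M + N * exp (- d) - (c - P) * exp d) / (c + M + N - (c - P))
      \<le> C * exp ((d * (c - N) - (c - P) * d) / (c + M + N - (c - P)))"
    using remove_constant_part[OF step] by blast
  moreover have "c * exp d + M + N * exp (- d) - (c - P) * exp d = P * exp d + M + N * exp (- d)"
    "d * (c - N) - (c - P) * d = d * (P - N)" "c + M + N - (c - P) = P + M + N"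
    by (simp_all add: algebra_simps)
  ultimately show ?thesis
    unfolding M_def[symmetric] by (simp only:)
qed

lemma E_three_values:
  assumes x: "fst x = d * (c - e)" "snd x = c * exp d + (1 - c - e) + e * exp (- d)"
    and full: "snd x \<le> C * exp (fst x)"
    and ce: "0 \<le> c" "0 \<le> e" "c + e \<le> 1"
    and lo: "xm \<le> d * (c - e)" and hi: "d * c + xp * e \<le> xp"
  defines "g \<equiv> (\<lambda>t. d * (indicator {0<..<c} t - indicator {1 - e<..<1} t))"
  shows "g \<in> E C x"
proof (rule in_EI)
  have g1: "g t = d" if "0 < t" "t < c" for t
    using that ce by (auto simp: g_def)
  have g2: "g t = 0" if "c < t" "t < 1 - e" for t
    using that ce by (auto simp: g_def)
  have g3: "g t = - d" if "1 - e < t" "t < 1" for t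
    using that ce by (auto simp: g_def)
  have pieces: "has_abs_integral (\<lambda>t. F (g t)) ((r - a) * F d + (s - r) * F 0 + (b - s) * F (- d)) {a<..<b}"
    if "0 \<le> a" "a \<le> r" "r \<le> s" "s \<le> b" "b \<le> 1" "r = a \<or> r \<le> c" "r = s \<or> (c \<le> r \<and> s \<le> 1 - e)" "s = b \<or> 1 - e \<le> s"
    for a b r s and F :: "real \<Rightarrow> real"
    by (rule has_abs_integral_three_step) (use that ce g1 g2 g3 in \<open>auto\<close>)
  show "has_abs_integral g (fst x) Q"
    by (rule has_abs_integral_cong[OF pieces[of 0 c "1 - e" 1 "\<lambda>y. y"]]) (use ce x in \<open>auto simp: algebra_simps\<close>)
  show "has_abs_integral (\<lambda>t. exp (g t)) (snd x) Q"
    by (rule has_abs_integral_cong[OF pieces[of 0 c "1 - e" 1 exp]]) (use ce x in \<open>auto simp: algebra_simps\<close>)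
  fix a b I W
  assume ab: "0 \<le> a" "a < b" "b \<le> 1"
    and I: "has_abs_integral g I {a<..<b}" and W: "has_abs_integral (\<lambda>t. exp (g t)) W {a<..<b}"
  consider "c \<le> a" | "b \<le> 1 - e" | "a < c" "1 - e < b" by linarith
  then show "W / (b - a) \<le> C * exp (I / (b - a))"
  proof cases
    case 1
    show ?thesis
      by (rule oscillation_criterion[OF I W ab(2), of "- d"])
         (use 1 xi_bounds in \<open>auto simp: g_def split: split_indicator\<close>)
  next
    case 2
    show ?thesis
      by (rule oscillation_criterion[OF I W ab(2), of 0])
         (use 2 xi_bounds in \<open>auto simp: g_def split: split_indicator\<close>)
  next
    case 3
    have I': "I = d * ((c - a) - (b - (1 - e)))"
      using has_abs_integral_unique[OF I pieces[of a c "1 - e" b "\<lambda>y. y"]] 3 ab ce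
      by (simp add: algebra_simps)
    have W': "W = (c - a) * exp d + (1 - c - e) + (b - (1 - e)) * exp (- d)"
      using has_abs_integral_unique[OF W pieces[of a c "1 - e" b exp]] 3 ab ce
      by (simp add: algebra_simps)
    have "b - a = (c - a) + (1 - c - e) + (b - (1 - e))" by simp
    then show ?thesis
      unfolding I' W'
      using three_values_bound[of c e "c - a" "b - (1 - e)"] full lo hi ce 3 ab unfolding x
      by simp
  qed
qed

lemma tline_chord: "tline xp u (u + d * \<theta>) = \<theta> * exp (u + d) + (1 - \<theta>) * exp u"
proof -
  define k where "k = 1 / (1 - xp)"
  have *: "tline xp u (u + d * \<theta>) = exp u * (1 + k * d * \<theta>)" "exp (u + d) = exp u * (1 + k * d)"
    using exp_d_eq unfolding exp_add[of u d] by (simp_all add: tline_def k_def)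
  show ?thesis
    unfolding * by (simp add: algebra_simps)
qed

lemma \<Omega>_plus_up:
  assumes "x \<in> \<Omega> C" "x \<in> \<Omega>_plus C"
  shows "0 \<le> up C x" "0 \<le> fst x"
  using assms(2) xp
  by (auto intro!: up_ge[OF assms(1)] simp: \<Omega>_plus_def tline_def tangent_slopes)

lemma \<Omega>_minus_um:
  assumes "x \<in> \<Omega> C" "x \<in> \<Omega>_minus C"
  shows "um C x \<le> 0" "fst x \<le> 0"
  using assms(2) xm
  by (auto intro!: um_le[OF assms(1)] simp: \<Omega>_minus_def tline_def tangent_slopes)

lemma \<Omega>_cover: "x \<in> \<Omega> C \<Longrightarrow> x \<in> \<Omega>_plus C \<or> x \<in> \<Omega>_minus C \<or> x \<in> \<Omega>_zero C"
  by (auto simp: \<Omega>_def \<Omega>_plus_def \<Omega>_minus_def \<Omega>_zero_def)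

lemma \<psi>_plus:
  assumes x: "x \<in> \<Omega> C" "x \<in> \<Omega>_plus C"
  shows "\<psi> C x \<in> E C x" "0 \<le> \<psi> C x t" "has_abs_integral (\<psi> C x) (fst x) Q"
proof -
  define \<beta> where "\<beta> = (fst x - up C x) / d"
  have \<psi>: "\<psi> C x = (\<lambda>t. up C x + d * indicator {0<..<\<beta>} t)"
    using x by (auto simp: \<psi>_def \<beta>_def Let_def)
  have \<beta>: "0 \<le> \<beta>" "\<beta> \<le> 1" "fst x = up C x + d * \<beta>"
    using up[OF x(1)] xi_bounds by (auto simp: \<beta>_def)
  show \<psi>_int: "has_abs_integral (\<psi> C x) (fst x) Q"
    by (rule has_abs_integral_two_step[of 0 \<beta> 1 _ "up C x + d" "up C x"])
       (use \<beta> in \<open>auto simp: \<psi> algebra_simps\<close>)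
  have "snd x = (\<beta> - 0) * exp (up C x + d) + (1 - \<beta>) * exp (up C x)"
    using up(3)[OF x(1)] \<beta>(3) tline_chord by (metis diff_zero)
  then have \<psi>_exp: "has_abs_integral (\<lambda>t. exp (\<psi> C x t)) (snd x) Q"
    by (intro has_abs_integral_two_step[of 0 \<beta> 1]) (use \<beta> in \<open>auto simp: \<psi>\<close>)
  show "\<psi> C x \<in> E C x"
    by (rule E_small_oscillation[OF \<psi>_int \<psi>_exp, of "up C x"])
       (use xi_bounds in \<open>auto simp: \<psi> split: split_indicator\<close>)
  show "0 \<le> \<psi> C x t"
    using \<Omega>_plus_up[OF x] xi_bounds by (auto simp: \<psi> split: split_indicator)
qed

lemma \<psi>_minus:
  assumes x: "x \<in> \<Omega> C" "x \<in> \<Omega>_minus C" "x \<notin> \<Omega>_plus C"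
  shows "\<psi> C x \<in> E C x" "\<psi> C x t \<le> 0" "has_abs_integral (\<psi> C x) (fst x) Q"
proof -
  define \<beta> where "\<beta> = (um C x - fst x) / d"
  have \<psi>: "\<psi> C x = (\<lambda>t. um C x - d * indicator {1 - \<beta><..<1} t)"
    using x by (auto simp: \<psi>_def \<beta>_def Let_def)
  have \<beta>: "0 \<le> \<beta>" "\<beta> \<le> 1" "fst x = um C x - d + d * (1 - \<beta>)"
    using um[OF x(1)] xi_bounds by (auto simp: \<beta>_def field_simps)
  show \<psi>_int: "has_abs_integral (\<psi> C x) (fst x) Q"
    by (rule has_abs_integral_two_step[of 0 "1 - \<beta>" 1 _ "um C x" "um C x - d"])
       (use \<beta> in \<open>auto simp: \<psi> algebra_simps\<close>)
  have "snd x = (1 - \<beta> - 0) * exp (um C x) + (1 - (1 - \<beta>)) * exp (um C x - d)"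
    using um(3)[OF x(1)] \<beta>(3) tline_chord[of "um C x - d" "1 - \<beta>"] unfolding tline_xm
    by (metis diff_zero diff_add_cancel)
  then have \<psi>_exp: "has_abs_integral (\<lambda>t. exp (\<psi> C x t)) (snd x) Q"
    by (intro has_abs_integral_two_step[of 0 "1 - \<beta>" 1]) (use \<beta> in \<open>auto simp: \<psi>\<close>)
  show "\<psi> C x \<in> E C x"
    by (rule E_small_oscillation[OF \<psi>_int \<psi>_exp, of "um C x - d"])
       (use xi_bounds in \<open>auto simp: \<psi> split: split_indicator\<close>)
  show "\<psi> C x t \<le> 0"
    using \<Omega>_minus_um[OF x(1,2)] xi_bounds by (auto simp: \<psi> split: split_indicator)
qed

definition \<gamma>p :: "real \<times> real \<Rightarrow> real" where
  "\<gamma>p x = ((snd x - 1) * (1 - xm) * (1 - xp) - fst x * (1 - xp)) / d\<^sup>2"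

definition \<gamma>m :: "real \<times> real \<Rightarrow> real" where
  "\<gamma>m x = ((snd x - 1) * (1 - xm) * (1 - xp) - fst x * (1 - xm)) / d\<^sup>2"

lemma gamma_moments:
  "fst x = d * (\<gamma>p x - \<gamma>m x)"
  "snd x = \<gamma>p x * exp d + (1 - \<gamma>p x - \<gamma>m x) + \<gamma>m x * exp (- d)"
proof -
  define T where "T = (snd x - 1) * (1 - xm) * (1 - xp)"
  have g: "\<gamma>p x * d\<^sup>2 = T - fst x * (1 - xp)" "\<gamma>m x * d\<^sup>2 = T - fst x * (1 - xm)"
    using xi_bounds by (auto simp: \<gamma>p_def \<gamma>m_def T_def)
  have "d * (\<gamma>p x - \<gamma>m x) * d = fst x * d"
    using g by (simp add: power2_eq_square algebra_simps)
  then show "fst x = d * (\<gamma>p x - \<gamma>m x)"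
    using xi_bounds by simp
  have A: "(\<gamma>p x * (1 - xm) - \<gamma>m x * (1 - xp)) * d * d = T * d"
    using arg_cong2[where f = "(-)", OF arg_cong[where f = "\<lambda>z. z * (1 - xm)", OF g(1)]
        arg_cong[where f = "\<lambda>z. z * (1 - xp)", OF g(2)]]
    by (simp add: power2_eq_square algebra_simps)
  then have "(\<gamma>p x * (1 - xm) - \<gamma>m x * (1 - xp)) * d = T"
    using xi_bounds by simp
  then have "(\<gamma>p x * (1 - xm) - \<gamma>m x * (1 - xp)) * d / ((1 - xm) * (1 - xp)) = snd x - 1"
    using xi_bounds by (simp add: T_def)
  moreover have "(\<gamma>p x * (1 - xm) - \<gamma>m x * (1 - xp)) * d / ((1 - xm) * (1 - xp)) =
      \<gamma>p x * (d / (1 - xp)) - \<gamma>m x * (d / (1 - xm))"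
    using xi_bounds by (simp add: field_simps)
  moreover have "d / (1 - xp) = exp d - 1"
    using exp_d_eq by simp
  moreover have "d / (1 - xm) = 1 - exp (- d)"
  proof -
    have "exp (- d) = (1 - xp) / (1 - xm)"
      using exp_d xi_bounds unfolding exp_minus by (simp add: field_simps)
    then show ?thesis using xi_bounds by (simp add: field_simps)
  qed
  ultimately have "snd x - 1 = \<gamma>p x * (exp d - 1) - \<gamma>m x * (1 - exp (- d))"
    by simp
  then show "snd x = \<gamma>p x * exp d + (1 - \<gamma>p x - \<gamma>m x) + \<gamma>m x * exp (- d)"
    by (simp only: algebra_simps)
qed

lemma \<Omega>_zero_gamma:
  assumes "x \<in> \<Omega>_zero C"
  shows "0 \<le> \<gamma>p x" "0 \<le> \<gamma>m x" "\<gamma>p x + \<gamma>m x \<le> 1" "d * \<gamma>p x + xp * \<gamma>m x \<le> xp"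
    "xm \<le> fst x" "snd x \<le> C * exp (fst x)"
proof -
  define T where "T = (snd x - 1) * (1 - xm) * (1 - xp)"
  have g: "\<gamma>p x = (T - fst x * (1 - xp)) / d\<^sup>2" "\<gamma>m x = (T - fst x * (1 - xm)) / d\<^sup>2"
    by (auto simp: \<gamma>p_def \<gamma>m_def T_def)
  show x: "xm \<le> fst x" "snd x \<le> C * exp (fst x)"
    using assms xp xm by (auto simp: \<Omega>_zero_def)
  have x': "fst x \<le> xp"
    using assms xp xm by (auto simp: \<Omega>_zero_def)
  have AB: "0 < (1 - xm) * (1 - xp)" using xi_bounds by simp
  have T_lower: "fst x * (1 - xp) \<le> T \<and> fst x * (1 - xm) \<le> T"
  proof (cases "fst x \<le> 0 \<and> fst x / (1 - xm) \<le> snd x - 1")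
    case True
    then have "fst x / (1 - xm) * ((1 - xm) * (1 - xp)) \<le> (snd x - 1) * ((1 - xm) * (1 - xp))"
      using AB by (intro mult_right_mono) auto
    then have "fst x * (1 - xp) \<le> T"
      using xi_bounds by (simp add: T_def mult.assoc)
    moreover have "fst x * (1 - xm) \<le> fst x * (1 - xp)"
      using True xi_bounds by (intro mult_left_mono_neg) auto
    ultimately show ?thesis by simp
  next
    case False
    then have *: "0 \<le> fst x" "fst x / (1 - xp) \<le> snd x - 1"
      using assms by (auto simp: \<Omega>_zero_def tangent_slopes)
    then have "fst x / (1 - xp) * ((1 - xm) * (1 - xp)) \<le> (snd x - 1) * ((1 - xm) * (1 - xp))"
      using AB by (intro mult_right_mono) auto
    then have "fst x * (1 - xm) \<le> T"
      using xi_bounds by (simp add: T_def mult.assoc)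
    moreover have "fst x * (1 - xp) \<le> fst x * (1 - xm)"
      using * xi_bounds by (intro mult_left_mono) auto
    ultimately show ?thesis by simp
  qed
  then show "0 \<le> \<gamma>p x" "0 \<le> \<gamma>m x"
    by (auto simp: g)
  have "exp (fst x) \<le> tline xp xm (fst x)"
    using x(1) x' by (intro exp_le_tline) auto
  then have "C * exp (fst x) \<le> C * tline xp xm (fst x)"
    using C_gt_1 by simp
  also have "\<dots> = (1 + (fst x - xm) / (1 - xp)) / (1 - xm)"
    unfolding tline_def mult.assoc[symmetric] tangent_slopes(2) by simp
  finally have "snd x \<le> (1 + (fst x - xm) / (1 - xp)) / (1 - xm)"
    using x(2) by simp
  then have "snd x * ((1 - xm) * (1 - xp)) \<le> (1 + (fst x - xm) / (1 - xp)) / (1 - xm) * ((1 - xm) * (1 - xp))"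
    using AB by (intro mult_right_mono) auto
  also have "\<dots> = (1 - xp) + (fst x - xm)"
  proof -
    have "(1 + z / B) / A * (A * B) = B + z" if "0 < A" "0 < B" for A B z :: real
      using that by (simp add: field_simps)
    then show ?thesis using xi_bounds by simp
  qed
  finally have T_upper: "T \<le> fst x - xm * xp"
    by (simp add: T_def algebra_simps)
  \<comment> \<open>The left-hand side is affine in x, so by convexity of exp it is enough to bound it at the two
    points of tangency; T_upper is that convexity.\<close>
  have "d * (T - fst x * (1 - xp)) + xp * (T - fst x * (1 - xm)) =
        (d + xp) * T - fst x * (d + xp - xp * xp)"
    by (simp add: algebra_simps)
  also have "\<dots> \<le> (d + xp) * (fst x - xm * xp) - fst x * (d + xp - xp * xp)"
    using T_upper xi_bounds by (intro diff_right_mono mult_left_mono) auto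
  also have "\<dots> = fst x * (xp * xp) - (d + xp) * (xm * xp)"
    by (simp add: algebra_simps)
  also have "\<dots> \<le> xp * (xp * xp) - (d + xp) * (xm * xp)"
    using x' xi_bounds by (intro diff_right_mono mult_right_mono) auto
  also have "\<dots> = xp * d\<^sup>2"
    by (simp add: power2_eq_square algebra_simps)
  finally have "(d * (T - fst x * (1 - xp)) + xp * (T - fst x * (1 - xm))) / d\<^sup>2 \<le> xp"
    using xi_bounds by (simp add: divide_le_eq)
  then show hi: "d * \<gamma>p x + xp * \<gamma>m x \<le> xp"
    by (simp add: g add_divide_distrib)
  have "xp * \<gamma>p x \<le> d * \<gamma>p x"
    using xi_bounds \<open>0 \<le> \<gamma>p x\<close> by (intro mult_right_mono) auto
  then have "xp * (\<gamma>p x + \<gamma>m x) \<le> xp * 1"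
    using hi by (simp add: algebra_simps)
  then show "\<gamma>p x + \<gamma>m x \<le> 1"
    using xi_bounds by simp
qed

lemma \<psi>_zero_eq:
  assumes x: "x \<in> \<Omega> C" "x \<in> \<Omega>_zero C" "x \<notin> \<Omega>_plus C"
  shows "\<psi> C x = (\<lambda>t. d * (indicator {0<..<\<gamma>p x} t - indicator {1 - \<gamma>m x<..<1} t))"
proof (cases "x \<in> \<Omega>_minus C")
  case False
  then show ?thesis
    using x by (auto simp: \<psi>_def \<gamma>p_def \<gamma>m_def Let_def)
next
  case True
  have line: "snd x = 1 + fst x / (1 - xm)"
  proof (cases "fst x \<le> xm")
    case le: True
    with x(2) xm xi_bounds have "fst x = xm" "1 + xm / (1 - xm) \<le> snd x" "snd x \<le> 1 / (1 - xm)"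
      by (auto simp: \<Omega>_zero_def tangent_slopes)
    moreover have "1 + xm / (1 - xm) = 1 / (1 - xm)"
      using xi_bounds by (simp add: field_simps)
    ultimately show ?thesis by simp
  next
    case False
    with True have "fst x \<le> 0" "snd x \<le> 1 + fst x / (1 - xm)"
      by (auto simp: \<Omega>_minus_def tangent_slopes)
    moreover have "1 + fst x / (1 - xm) \<le> snd x"
      using x(2) \<open>fst x \<le> 0\<close> by (auto simp: \<Omega>_zero_def tangent_slopes)
    ultimately show ?thesis by simp
  qed
  have um0: "um C x = 0"
  proof (rule antisym)
    show "um C x \<le> 0" using \<Omega>_minus_um[OF x(1) True] by simp
    have "xm \<le> fst x" using \<Omega>_zero_gamma[OF x(2)] by simp
    then have "tline xm (um C x) (fst x) < tline xm 0 (fst x)" if "um C x < 0"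
      using tline_less(2)[OF xi_bounds(4) that, of "fst x"] by simp
    then show "0 \<le> um C x"
      using um(3)[OF x(1)] line by (force simp: tline_def)
  qed
  have T: "(snd x - 1) * (1 - xm) * (1 - xp) = fst x * (1 - xp)"
    using xi_bounds by (simp add: line)
  have D: "fst x * (1 - xp) - fst x * (1 - xm) = - fst x * d"
    by (simp add: algebra_simps)
  have "\<gamma>p x = 0" "\<gamma>m x = - fst x / d"
    unfolding \<gamma>p_def \<gamma>m_def T D by (simp_all add: power2_eq_square)
  then show ?thesis
    using x True um0 by (auto simp: \<psi>_def Let_def)
qed

lemma \<psi>_zero_in_E:
  assumes x: "x \<in> \<Omega> C" "x \<in> \<Omega>_zero C" "x \<notin> \<Omega>_plus C"
  shows "\<psi> C x \<in> E C x"
  unfolding \<psi>_zero_eq[OF x]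
  by (rule E_three_values) (use gamma_moments[of x] \<Omega>_zero_gamma[OF x(2)] in auto)

lemma has_abs_integral_\<psi>_zero:
  assumes x: "x \<in> \<Omega> C" "x \<in> \<Omega>_zero C" "x \<notin> \<Omega>_plus C"
  shows "has_abs_integral (\<lambda>t. F (\<psi> C x t))
    (\<gamma>p x * F d + (1 - \<gamma>p x - \<gamma>m x) * F 0 + \<gamma>m x * F (- d)) Q"
  by (rule has_abs_integral_cong[OF has_abs_integral_three_step[of 0 "\<gamma>p x" "1 - \<gamma>m x" 1 _ "F d" "F 0" "F (- d)"]])
     (use \<Omega>_zero_gamma[OF x(2)] in \<open>auto simp: \<psi>_zero_eq[OF x] algebra_simps\<close>)

lemma \<psi>_in_E:
  assumes "x \<in> \<Omega> C"
  shows "\<psi> C x \<in> E C x"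
  using \<Omega>_cover[OF assms] \<psi>_plus(1)[OF assms] \<psi>_minus(1)[OF assms] \<psi>_zero_in_E[OF assms] by blast

lemma \<psi>_optimizer_b1:
  assumes x: "x \<in> \<Omega> C"
  shows "optimizer C (\<lambda>t. \<bar>t\<bar>) (b1_cand C) x (\<psi> C x)"
proof (rule optimizerI[OF \<psi>_in_E[OF x]])
  consider "x \<in> \<Omega>_plus C" | "x \<in> \<Omega>_minus C" "x \<notin> \<Omega>_plus C"
    | "x \<in> \<Omega>_zero C" "x \<notin> \<Omega>_plus C" "x \<notin> \<Omega>_minus C"
    using \<Omega>_cover[OF x] by blast
  then show "has_abs_integral (\<lambda>t. \<bar>\<psi> C x t\<bar>) (b1_cand C x) Q"
  proof cases
    case 1
    have "b1_cand C x = fst x"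
      using 1 \<Omega>_plus_up[OF x 1] \<Omega>_minus_um[OF x] by (auto simp: b1_cand_def)
    then show ?thesis
      using has_abs_integral_cong[OF \<psi>_plus(3)[OF x 1]] \<psi>_plus(2)[OF x 1] by simp
  next
    case 2
    have "has_abs_integral (\<lambda>t. \<bar>\<psi> C x t\<bar>) (- 1 * fst x) Q"
      by (rule has_abs_integral_cong[OF has_abs_integral_cmul[OF \<psi>_minus(3)[OF x 2], of "- 1"]])
         (use \<psi>_minus(2)[OF x 2] in auto)
    then show ?thesis
      using 2 by (simp add: b1_cand_def)
  next
    case 3
    define T where "T = (snd x - 1) * (1 - xm) * (1 - xp)"
    have "\<gamma>p x * \<bar>d\<bar> + (1 - \<gamma>p x - \<gamma>m x) * \<bar>0\<bar> + \<gamma>m x * \<bar>- d\<bar> = (\<gamma>p x + \<gamma>m x) * d"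
      using xi_bounds by (simp add: algebra_simps)
    also have "\<dots> = (2 * T + (xp + xm - 2) * fst x) / d"
    proof -
      have "\<gamma>p x + \<gamma>m x = (2 * T + (xp + xm - 2) * fst x) / d\<^sup>2"
        unfolding \<gamma>p_def \<gamma>m_def T_def add_divide_distrib[symmetric] by (simp add: algebra_simps)
      then show ?thesis
        using xi_bounds by (simp add: power2_eq_square)
    qed
    also have "\<dots> = 2 * (T / d) + (xp + xm - 2) / d * fst x"
      by (simp only: add_divide_distrib times_divide_eq_right times_divide_eq_left)
    also have "\<dots> = b1_cand C x"
      using 3 by (simp add: b1_cand_def T_def mult_ac)
    finally show ?thesis
      using has_abs_integral_\<psi>_zero[OF x 3(1,2), of abs] by simp
  qed
qed

end

subsection \<open>Optimizers for the indicator of a half line\<close>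

lemma has_abs_integral_replace_initial:
  assumes "has_abs_integral f I {0<..<b}" "has_abs_integral f J {0<..<s}" "has_abs_integral g J {0<..<s}"
    and "0 \<le> s" "s \<le> b" "\<And>t. s < t \<Longrightarrow> t < b \<Longrightarrow> g t = f t"
  shows "has_abs_integral g I {0<..<b}"
proof -
  obtain J' K where K: "has_abs_integral f J' {0<..<s}" "has_abs_integral f K {s<..<b}" "I = J' + K"
    using has_abs_integral_split[OF assms(1,4,5)] .
  have "has_abs_integral g K {s<..<b}"
    by (rule has_abs_integral_cong[OF K(2)]) (use assms(6) in auto)
  from has_abs_integral_combine[OF assms(3) this assms(4,5)] show ?thesis
    using K(3) has_abs_integral_unique[OF K(1) assms(2)] by simp
qed

definition shift :: "real \<Rightarrow> real \<times> real \<Rightarrow> real \<times> real" where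
  "shift lam x = (fst x - lam, snd x * exp (- lam))"

lemma le_mult_exp_minus:
  fixes a b lam :: real
  shows "a \<le> b * exp (- lam) \<longleftrightarrow> exp lam * a \<le> b" "b * exp (- lam) \<le> a \<longleftrightarrow> b \<le> exp lam * a"
  by (simp_all add: exp_minus field_simps)

lemma exp_mult_exp_diff:
  fixes z lam :: real
  shows "exp lam * exp (z - lam) = exp z" "exp lam * (c * exp (z - lam)) = c * exp z"
  by (simp_all add: exp_diff)

lemma shift_mem:
  "shift lam x \<in> \<Omega> C \<longleftrightarrow> x \<in> \<Omega> C"
  "shift lam x \<in> \<Omega>_zero C \<longleftrightarrow> x \<in> \<Omega>3 lam C"
  "shift lam x \<in> \<Omega>_plus C \<longleftrightarrow> x \<in> \<Omega>4 lam C"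
  by (cases x; simp add: shift_def \<Omega>_def \<Omega>_zero_def \<Omega>_plus_def \<Omega>3_def \<Omega>4_def
      le_mult_exp_minus exp_mult_exp_diff diff_le_eq le_diff_eq add.commute[of lam])+

context A_infty_bound
begin

lemma \<eta>_shift:
  assumes "x \<in> \<Omega>3 lam C \<union> \<Omega>4 lam C"
  shows "\<eta> lam C x = (\<lambda>t. lam + \<psi> C (shift lam x) t)"
  using assms by (auto simp: \<eta>_def shift_def)

lemma \<eta>_shift_in_E:
  assumes "x \<in> \<Omega> C" "x \<in> \<Omega>3 lam C \<union> \<Omega>4 lam C"
  shows "\<eta> lam C x \<in> E C x"
  by (rule E_transfer[OF \<psi>_in_E, of "shift lam x" "{}" _ lam])
     (use assms in \<open>auto simp: \<eta>_shift shift_mem, auto simp: shift_def exp_minus\<close>)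

lemma \<eta>_optimizer_4:
  assumes x: "x \<in> \<Omega> C" "x \<in> \<Omega>4 lam C"
  shows "optimizer C (indicator {lam..}) (D_cand lam C) x (\<eta> lam C x)"
proof (rule optimizerI)
  show "\<eta> lam C x \<in> E C x"
    using \<eta>_shift_in_E x by blast
  have "has_abs_integral (\<lambda>_. 1) (1 * (1 - 0)) Q"
    by (rule has_abs_integral_const) simp
  then show "has_abs_integral (\<lambda>t. indicator {lam..} (\<eta> lam C x t)) (D_cand lam C x) Q"
    by (rule has_abs_integral_cong)
       (use x \<psi>_plus(2)[of "shift lam x"] in \<open>auto simp: \<eta>_shift shift_mem D_cand_def\<close>)
qed

lemma \<eta>_optimizer_3:
  assumes x: "x \<in> \<Omega> C" "x \<in> \<Omega>3 lam C" "x \<notin> \<Omega>4 lam C"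
  shows "optimizer C (indicator {lam..}) (D_cand lam C) x (\<eta> lam C x)"
proof (rule optimizerI)
  show "\<eta> lam C x \<in> E C x"
    using \<eta>_shift_in_E x by blast
  define y where "y = shift lam x"
  have "has_abs_integral (\<lambda>t. indicator {lam..} (lam + \<psi> C y t))
      (\<gamma>p y * indicator {lam..} (lam + d) + (1 - \<gamma>p y - \<gamma>m y) * indicator {lam..} (lam + 0) +
        \<gamma>m y * indicator {lam..} (lam + - d)) Q"
    using has_abs_integral_\<psi>_zero[of y "\<lambda>z. indicator {lam..} (lam + z)"] x
    by (simp add: y_def shift_mem)
  moreover have "D_cand lam C x = 1 - \<gamma>m y"
  proof -
    have "(1 - xm) / d\<^sup>2 * (z + (1 - w) * (1 - xp)) + 1 =
        1 - ((w - 1) * (1 - xm) * (1 - xp) - z * (1 - xm)) / d\<^sup>2" for z w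
    proof -
      have "(1 - xm) * (z + (1 - w) * (1 - xp)) = - ((w - 1) * (1 - xm) * (1 - xp) - z * (1 - xm))"
        by (simp add: algebra_simps)
      then show ?thesis
        unfolding times_divide_eq_left by (simp only: minus_divide_left[symmetric])
    qed
    then show ?thesis
      using x by (simp add: D_cand_def \<gamma>m_def y_def shift_def)
  qed
  ultimately show "has_abs_integral (\<lambda>t. indicator {lam..} (\<eta> lam C x t)) (D_cand lam C x) Q"
    using x xi_bounds by (simp add: \<eta>_shift y_def)
qed

lemma v_coord:
  assumes x: "x \<in> \<Omega>2 lam C"
  shows "lam - d \<le> v_coord lam x" "v_coord lam x \<le> fst x" "fst x < lam"
    and "(exp lam - exp (v_coord lam x)) * (lam - fst x) = (exp lam - snd x) * (lam - v_coord lam x)"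
proof -
  have x1: "fst x < lam" "lam - d \<le> fst x" "exp (fst x) \<le> snd x"
    and x2: "snd x \<le> exp lam * (1 / (1 - xm) * (fst x - lam) + 1)"
    using x unfolding \<Omega>2_def tangent_slopes by auto
  let ?h = "\<lambda>v. (exp lam - exp v) * (lam - fst x) - (exp lam - snd x) * (lam - v)"
  have "exp lam - exp (lam - d) = exp lam * (d / (1 - xm))"
  proof -
    have "exp d = (1 - xm) / (1 - xp)"
      using exp_d xi_bounds by (simp add: field_simps)
    then have "exp (lam - d) = exp lam * ((1 - xp) / (1 - xm))"
      unfolding exp_diff[of lam d] by simp
    moreover have "d / (1 - xm) = 1 - (1 - xp) / (1 - xm)"
      using xi_bounds by (simp add: field_simps)
    ultimately show ?thesis by (simp only: right_diff_distrib mult_1_right)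
  qed
  then have "?h (lam - d) = (exp lam * ((lam - fst x) / (1 - xm)) - (exp lam - snd x)) * d"
    by (simp only:) (simp add: algebra_simps)
  moreover have "exp lam * ((lam - fst x) / (1 - xm)) - (exp lam - snd x) \<le> 0"
  proof -
    define z where "z = 1 / (1 - xm) * (fst x - lam)"
    have "(lam - fst x) / (1 - xm) = - z"
      by (simp add: z_def minus_divide_left)
    then show ?thesis
      using x2[folded z_def] by (simp add: algebra_simps)
  qed
  ultimately have "?h (lam - d) \<le> 0"
    using xi_bounds by (simp add: mult_nonpos_nonneg)
  moreover have "0 \<le> ?h (fst x)"
    using x1 by (simp flip: left_diff_distrib)
  moreover have "continuous_on {lam - d..fst x} ?h"
    by (intro continuous_intros)
  ultimately obtain v where v: "lam - d \<le> v" "v \<le> fst x" "?h v = 0"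
    using IVT'[of ?h "lam - d" 0 "fst x"] x1(2) by blast
  have iff: "(exp w - exp lam) / (w - lam) = (snd x - exp lam) / (fst x - lam) \<longleftrightarrow> ?h w = 0"
    if "w < lam" for w
  proof -
    have "w - lam \<noteq> 0" "fst x - lam \<noteq> 0" using that x1 by auto
    then have "(exp w - exp lam) / (w - lam) = (snd x - exp lam) / (fst x - lam) \<longleftrightarrow>
        (exp w - exp lam) * (fst x - lam) = (snd x - exp lam) * (w - lam)"
      by (rule frac_eq_eq)
    also have "\<dots> \<longleftrightarrow> ?h w = 0"
      by (auto simp: algebra_simps)
    finally show ?thesis .
  qed
  have no: "\<not> (?h w = 0 \<and> ?h w' = 0)" if "w < w'" "w' < lam" for w w'
  proof
    assume h: "?h w = 0 \<and> ?h w' = 0"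
    define k where "k = (exp lam - snd x) / (lam - fst x)"
    have "exp lam - exp w = k * (lam - w)" "exp lam - exp w' = k * (lam - w')"
      using h x1 by (auto simp: k_def field_simps)
    then have "exp w' - exp w = k * (w' - w)" "exp lam - exp w' = k * (lam - w')"
      by (simp_all add: algebra_simps)
    then show False
      using exp_strict_convex[OF that] by simp
  qed
  have "v_coord lam x = v"
    unfolding v_coord_def
  proof (rule the_equality)
    show "v < lam \<and> (exp v - exp lam) / (v - lam) = (snd x - exp lam) / (fst x - lam)"
      using v x1 iff[of v] by simp
    fix w assume "w < lam \<and> (exp w - exp lam) / (w - lam) = (snd x - exp lam) / (fst x - lam)"
    then show "w = v"
      using iff[of w] no[of v w] no[of w v] v x1 by (cases w v rule: linorder_cases) auto
  qed
  then show "lam - d \<le> v_coord lam x" "v_coord lam x \<le> fst x" "fst x < lam"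
    "(exp lam - exp (v_coord lam x)) * (lam - fst x) = (exp lam - snd x) * (lam - v_coord lam x)"
    using v x1 by auto
qed

lemma \<eta>_optimizer_2:
  assumes x: "x \<in> \<Omega> C" "x \<in> \<Omega>2 lam C" "x \<notin> \<Omega>3 lam C" "x \<notin> \<Omega>4 lam C"
  shows "optimizer C (indicator {lam..}) (D_cand lam C) x (\<eta> lam C x)"
proof (rule optimizerI)
  define v where "v = v_coord lam x"
  define \<mu> where "\<mu> = (fst x - v) / (lam - v)"
  note v = v_coord[OF x(2), folded v_def]
  have \<mu>: "0 \<le> \<mu>" "\<mu> \<le> 1" "fst x = \<mu> * lam + (1 - \<mu>) * v"
  proof -
    show "0 \<le> \<mu>" "\<mu> \<le> 1" using v by (auto simp: \<mu>_def)
    have "\<mu> * (lam - v) = fst x - v" using v by (simp add: \<mu>_def)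
    then show "fst x = \<mu> * lam + (1 - \<mu>) * v" by (simp add: algebra_simps)
  qed
  have \<eta>: "\<eta> lam C x t = lam * indicator {0<..<\<mu>} t + v * indicator {\<mu><..<1} t" for t
    using x by (simp add: \<eta>_def \<mu>_def v_def Let_def)
  define g where "g t = (if t < \<mu> then lam else v)" for t
  have g_int: "has_abs_integral g (fst x) Q"
    by (rule has_abs_integral_two_step[of 0 \<mu> 1 _ lam v]) (use \<mu> in \<open>auto simp: g_def\<close>)
  have "snd x = \<mu> * exp lam + (1 - \<mu>) * exp v"
  proof -
    define k where "k = (exp lam - exp v) / (lam - v)"
    have eqs: "exp v = exp lam - k * (lam - v)" "snd x = exp lam - k * (lam - fst x)"
      using v by (auto simp: k_def field_simps)
    have "\<mu> * (k * (lam - v)) = k * (fst x - v)"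
      using v by (simp add: \<mu>_def)
    moreover have "\<mu> * exp lam + (1 - \<mu>) * (exp lam - k * (lam - v)) =
        exp lam - k * (lam - v) + \<mu> * (k * (lam - v))"
      by (simp add: algebra_simps)
    ultimately show ?thesis
      unfolding eqs by (simp add: algebra_simps)
  qed
  then have g_exp: "has_abs_integral (\<lambda>t. exp (g t)) (snd x) Q"
    by (intro has_abs_integral_two_step[of 0 \<mu> 1 _ "exp lam" "exp v"]) (use \<mu> in \<open>auto simp: g_def\<close>)
  have "g \<in> E C x"
    by (rule E_small_oscillation[OF g_int g_exp, of v]) (use v xi_bounds in \<open>auto simp: g_def\<close>)
  then show "\<eta> lam C x \<in> E C x"
    by (rule E_transfer[where N = "{\<mu>}" and c = 0]) (use \<mu> in \<open>auto simp: \<eta> g_def\<close>)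
  have "D_cand lam C x = \<mu>"
    using x by (simp add: D_cand_def \<mu>_def v_def)
  then show "has_abs_integral (\<lambda>t. indicator {lam..} (\<eta> lam C x t)) (D_cand lam C x) Q"
    by (intro has_abs_integral_two_step[of 0 \<mu> 1 _ 1 0]) (use \<mu> v in \<open>auto simp: \<eta>\<close>)
qed

lemma up_le_outer:
  assumes x: "x \<in> \<Omega> C" "x \<notin> \<Omega>2 lam C" "x \<notin> \<Omega>3 lam C" "x \<notin> \<Omega>4 lam C"
  shows "up C x \<le> lam - d"
proof (cases "fst x \<le> lam - d")
  case True
  then show ?thesis using up(2)[OF x(1)] by simp
next
  case False
  have "fst x < lam"
    using x by (force simp: \<Omega>_def \<Omega>4_def \<Omega>3_def)
  then have *: "exp lam * (C * exp xm * (fst x - lam) + 1) \<le> snd x" "fst x \<le> lam + xm"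
    using x False by (force simp: \<Omega>_def \<Omega>2_def \<Omega>3_def)+
  have "tline xp (lam - d) (fst x) = exp lam * (C * exp xm * (fst x - lam) + 1)"
    unfolding tline_xm[symmetric] tangent_slopes by (simp add: tline_def)
  then show ?thesis
    using * by (intro up_le[OF x(1)]) auto
qed

lemma \<eta>_optimizer_1:
  assumes x: "x \<in> \<Omega> C" "x \<notin> \<Omega>2 lam C" "x \<notin> \<Omega>3 lam C" "x \<notin> \<Omega>4 lam C"
  shows "optimizer C (indicator {lam..}) (D_cand lam C) x (\<eta> lam C x)"
proof (rule optimizerI)
  define u where "u = up C x"
  define \<tau> where "\<tau> = exp ((u + xp - xm - lam) / xp)"
  define \<alpha> where "\<alpha> = (fst x - u) / xp"
  define r where "r = \<tau> * ((fst x - u) / d)"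
  define s where "s = \<tau> * \<alpha>"
  define v where "v = lam - d"
  have \<tau>: "0 < \<tau>" "\<tau> \<le> 1" "xp * ln \<tau> = u - v"
    using up_le_outer[OF x] xi_bounds by (auto simp: \<tau>_def u_def v_def divide_le_0_iff)
  have \<alpha>: "0 \<le> \<alpha>" "\<alpha> \<le> 1"
    using \<alpha>p_bounds[OF x(1)] by (auto simp: \<alpha>_def u_def)
  have s: "0 \<le> s" "s \<le> \<alpha>" "s \<le> 1"
    using \<tau> \<alpha> mult_left_le_one_le[of \<alpha> \<tau>] mult_le_one[of \<tau> \<alpha>] by (auto simp: s_def)
  have rs: "r * d = s * xp"
    using xi_bounds by (simp add: r_def s_def \<alpha>_def)
  have r: "0 \<le> r" "r \<le> s"
  proof -
    have "s * xp \<le> s * d"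
      using s xi_bounds by (intro mult_left_mono) auto
    then have "r * d \<le> s * d" by (simp add: rs)
    then show "r \<le> s" using xi_bounds by simp
    have "0 \<le> r * d" using s xi_bounds by (simp add: rs)
    then show "0 \<le> r" using xi_bounds by (simp add: zero_le_mult_iff)
  qed
  have \<phi>: "\<phi>p C x t = u + xp * tlog \<alpha> t" if "0 < t" for t
    using \<phi>p_eq[OF x(1) that] by (simp add: u_def \<alpha>_def)
  have \<phi>_head: "\<phi>p C x t = v + xp * tlog s t" if "0 < t" "t \<le> s" for t
  proof -
    have "0 < s" using that by simp
    then have "0 < \<alpha>" using \<tau> by (simp add: s_def zero_less_mult_iff)
    then have "tlog \<alpha> s = - ln \<tau>"
      using \<tau> \<open>0 < s\<close> s by (simp add: tlog_simps ln_div) (simp add: s_def ln_mult)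
    moreover have "min \<alpha> s = s" using s by simp
    ultimately show ?thesis
      using \<phi>[OF that(1)] tlog_rescale[OF \<alpha>(1) that] \<tau>(3) by (simp add: algebra_simps)
  qed
  have \<phi>_tail: "\<phi>p C x t \<le> v" if "0 < t" "s \<le> t" for t
  proof (cases "s = 0")
    case True
    then have "\<alpha> = 0" using \<tau> by (simp add: s_def)
    then show ?thesis
      using \<phi>[OF that(1)] that up_le_outer[OF x] by (simp add: tlog_simps v_def u_def)
  next
    case False
    then have "\<phi>p C x t \<le> \<phi>p C x s"
      using \<phi> tlog_antimono[OF \<alpha>(1), of s t] s that xp by (auto intro!: mult_left_mono)
    also have "\<dots> = v"
      using \<phi>_head[of s] False s by (simp add: tlog_simps)
    finally show ?thesis .
  qed
  \<comment> \<open>The values lam and v replace the logarithm on (0, s) without changing its averages there, because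
    the averages of the logarithm lie on the chord from v to lam = v + d.\<close>
  define g where "g t = (if t \<le> r then lam else if t \<le> s then v else \<phi>p C x t)" for t
  have head: "has_abs_integral g (s * v + s * xp) {0<..<s}"
       "has_abs_integral (\<lambda>t. exp (g t)) (exp v * (s + s * xp / (1 - xp))) {0<..<s}"
  proof -
    show "has_abs_integral g (s * v + s * xp) {0<..<s}"
      by (rule has_abs_integral_two_step[of 0 r s _ lam v])
         (use r rs in \<open>auto simp: g_def v_def algebra_simps\<close>)
    define k where "k = 1 / (1 - xp)"
    have "exp lam = exp v * (1 + k * d)"
      unfolding k_def exp_d_eq[symmetric] v_def by (simp flip: exp_add)
    then have "(r - 0) * exp lam + (s - r) * exp v = exp v * (s + k * (r * d))"
      by (simp only:) (simp add: algebra_simps)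
    then show "has_abs_integral (\<lambda>t. exp (g t)) (exp v * (s + s * xp / (1 - xp))) {0<..<s}"
      by (intro has_abs_integral_two_step[of 0 r s _ "exp lam" "exp v"])
         (use r rs in \<open>auto simp: g_def k_def\<close>)
  qed
  have \<phi>_head_int: "has_abs_integral (\<phi>p C x) (s * v + s * xp) {0<..<s}"
       "has_abs_integral (\<lambda>t. exp (\<phi>p C x t)) (exp v * (s + s * xp / (1 - xp))) {0<..<s}"
  proof -
    show "has_abs_integral (\<phi>p C x) (s * v + s * xp) {0<..<s}"
      by (rule has_abs_integral_cong[OF has_abs_integral_log(1)[of s s v xp]]) (use s \<phi>_head in simp_all)
    show "has_abs_integral (\<lambda>t. exp (\<phi>p C x t)) (exp v * (s + s * xp / (1 - xp))) {0<..<s}"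
      by (rule has_abs_integral_cong[OF has_abs_integral_log(2)[of s s xp v]]) (use s \<phi>_head xp in simp_all)
  qed
  have tail: "has_abs_integral g I {0<..<b}" if "has_abs_integral (\<phi>p C x) I {0<..<b}" "s \<le> b" for I b
    by (rule has_abs_integral_replace_initial[OF that(1) \<phi>_head_int(1) head(1) s(1) that(2)])
       (use r in \<open>auto simp: g_def\<close>)
  have tail_exp: "has_abs_integral (\<lambda>t. exp (g t)) I {0<..<b}"
    if "has_abs_integral (\<lambda>t. exp (\<phi>p C x t)) I {0<..<b}" "s \<le> b" for I b
    by (rule has_abs_integral_replace_initial[OF that(1) \<phi>_head_int(2) head(2) s(1) that(2)])
       (use r in \<open>auto simp: g_def\<close>)
  have g_int: "has_abs_integral g (fst x) Q" "has_abs_integral (\<lambda>t. exp (g t)) (snd x) Q"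
    using tail tail_exp \<phi>p_moments[OF x(1)] s by auto
  have g_antimono: "g t' \<le> g t" if "0 < t" "t \<le> t'" for t t'
    using that \<phi>_tail[of t'] \<phi> tlog_antimono[OF \<alpha>(1) that] xp xi_bounds r
    by (auto simp: g_def v_def)
  have \<eta>: "\<eta> lam C x t = lam * indicator {0<..<r} t + v * indicator {r<..<s} t
      + \<phi>p C x t * indicator {s<..<1} t" for t
    using x by (simp add: \<eta>_def Let_def r_def s_def \<alpha>_def \<tau>_def u_def v_def)
  have \<eta>_eq_g: "\<eta> lam C x t = g t" if "t \<in> Q - {r, s}" for t
    using that r s by (auto simp: \<eta> g_def)
  have "g \<in> E C x"
  proof (rule E_antimono[OF g_int g_antimono])
    fix b :: real assume b: "0 < b" "b \<le> 1"
    consider "b \<le> r" | "r < b" "b \<le> s" | "s < b" by linarith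
    then show "\<exists>I W. has_abs_integral g I {0<..<b} \<and> has_abs_integral (\<lambda>t. exp (g t)) W {0<..<b} \<and>
       W \<le> b * tline xp (g b) (I / b)"
    proof cases
      case 1
      have "has_abs_integral g (lam * (b - 0)) {0<..<b}"
        "has_abs_integral (\<lambda>t. exp (g t)) (exp lam * (b - 0)) {0<..<b}"
        by (rule has_abs_integral_cong[OF has_abs_integral_const]; use b 1 in \<open>auto simp: g_def\<close>)+
      moreover have "exp lam * (b - 0) = b * tline xp (g b) (lam * (b - 0) / b)"
        using 1 b by (simp add: g_def tline_0)
      ultimately show ?thesis by (intro exI conjI) auto
    next
      case 2
      have "has_abs_integral g ((r - 0) * lam + (b - r) * v) {0<..<b}"
        by (rule has_abs_integral_two_step[of 0 r b]) (use r 2 in \<open>auto simp: g_def\<close>)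
      moreover have "has_abs_integral (\<lambda>t. exp (g t)) ((r - 0) * exp lam + (b - r) * exp v) {0<..<b}"
        by (rule has_abs_integral_two_step[of 0 r b]) (use r 2 in \<open>auto simp: g_def\<close>)
      moreover have "(r - 0) * exp lam + (b - r) * exp v = b * tline xp (g b) (((r - 0) * lam + (b - r) * v) / b)"
      proof -
        have "((r - 0) * lam + (b - r) * v) / b = v + d * (r / b)"
          using b by (simp add: v_def field_simps)
        then have "b * tline xp v (((r - 0) * lam + (b - r) * v) / b) =
            b * (r / b) * exp (v + d) + (b - b * (r / b)) * exp v"
          by (simp only: tline_chord) (simp add: algebra_simps)
        then show ?thesis
          using 2 b by (simp add: g_def v_def)
      qed
      ultimately show ?thesis by (intro exI conjI) auto
    next
      case 3
      obtain I where I: "has_abs_integral (\<phi>p C x) I {0<..<b}"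
         "has_abs_integral (\<lambda>t. exp (\<phi>p C x t)) (b * tline xp (\<phi>p C x b) (I / b)) {0<..<b}"
        using log_initial_segment[OF xp(2) \<alpha>(1) b(1) \<phi>] .
      have "g b = \<phi>p C x b" using 3 r by (simp add: g_def)
      then show ?thesis
        using tail[OF I(1)] tail_exp[OF I(2)] 3 by (intro exI conjI) auto
    qed
  qed
  then show "\<eta> lam C x \<in> E C x"
    by (rule E_transfer[where N = "{r, s}" and c = 0]) (use \<eta>_eq_g in auto)
  have g_less: "g t < lam" if "r < t" for t
    using that r \<phi>_tail[of t] xi_bounds by (auto simp: g_def v_def)
  have "has_abs_integral (\<lambda>t. indicator {lam..} (g t)) r Q"
    by (rule has_abs_integral_two_step[of 0 r 1 _ 1 0])
       (use r s g_less in \<open>simp_all add: not_le, simp add: g_def\<close>)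
  then have "has_abs_integral (\<lambda>t. indicator {lam..} (\<eta> lam C x t)) r Q"
    by (rule has_abs_integral_spike[where N = "{r, s}"]) (use \<eta>_eq_g in auto)
  moreover have "D_cand lam C x = r"
    using x by (simp add: D_cand_def r_def \<tau>_def u_def algebra_simps)
  ultimately show "has_abs_integral (\<lambda>t. indicator {lam..} (\<eta> lam C x t)) (D_cand lam C x) Q"
    by simp
qed

lemma \<eta>_optimizer_D:
  assumes "x \<in> \<Omega> C"
  shows "optimizer C (indicator {lam..}) (D_cand lam C) x (\<eta> lam C x)"
  using assms \<eta>_optimizer_1 \<eta>_optimizer_2 \<eta>_optimizer_3 \<eta>_optimizer_4 by blast

end

theorem lemma5p2:
  fixes C :: real and x :: "real \<times> real"
  assumes "C > 1" and "x \<in> \<Omega> C"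
  shows "(\<forall>p. 1 < p \<and> p \<le> 2 \<longrightarrow>
            optimizer C (\<lambda>t. \<bar>t\<bar> powr p) (b_cand p C) x (\<phi>p C x)) \<and>
         (\<forall>\<delta>. 1 \<le> \<delta> \<and> \<delta> < 1 / \<xi>p C \<longrightarrow>
            optimizer C (\<lambda>t. exp (\<delta> * t)) (A_cand \<delta> C) x (\<phi>p C x)) \<and>
         optimizer C (\<lambda>t. t^2) (B2_cand C) x (\<phi>m C x) \<and>
         optimizer C (\<lambda>t. \<bar>t\<bar>) (b1_cand C) x (\<psi> C x) \<and>
         (\<forall>lam. optimizer C (indicator {lam..}) (D_cand lam C) x (\<eta> lam C x))"
proof -
  interpret A_infty_bound C
    using assms(1) by unfold_locales
  show ?thesis
    using assms(2)
    by (intro conjI allI impI; (elim conjE)?)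
       (rule \<phi>p_optimizer_b \<phi>p_optimizer_A \<phi>m_optimizer_B \<psi>_optimizer_b1 \<eta>_optimizer_D; assumption)+
qed

end
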